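(* Let $d\ge1$ and let $H:\mathbb{R}^d\times\mathbb{R}^d\to\mathbb{R}$ and $G:\mathbb{R}^d\to\mathbb{R}$ satisfy the standing assumptions given in the context. Define $$\lambda_0:=\inf_{(x,p)\in\mathbb{R}^d\times\mathbb{R}^d}\lambda_{\min}\left(\mathrm{Re}\,\partial_{xp}H(x,p)\right),\qquad \lambda_H:=\sup_{(x,p)\in\mathbb{R}^d\times\mathbb{R}^d}\lambda_{\max}\left(\partial_{xx}H(x,p)\right),\qquad \lambda_G:=\inf_{x\in\mathbb{R}^d}\lambda_{\min}\left(\partial_{xx}G(x)\right).$$ Suppose that $$\lambda_0^2\ge\|\partial_{pp}H\|_\infty\,\lambda_H\qquad\text{and}\qquad \lambda_0+\sqrt{\lambda_0^2-\|\partial_{pp}H\|_\infty\,\lambda_H}+\|\partial_{pp}H\|_\infty\,\lambda_G\ge0 .$$ Furthermore, assume that either $\lambda_H\le0$ or $\lambda_0\ge0$. Then the Hamilton--Jacobi equation $$-\partial_t u(t,x)+H(x,\partial_x u(t,x))=0\ \text{ in }(0,T)\times\mathbb{R}^d,\qquad u(T,x)=G(x),\ x\in\mathbb{R}^d,$$ is globally well-posed, for any $T>0$, in the class $C^{1,1}_{\mathrm{loc}}([0,T]\times\mathbb{R}^d)$.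
   Context: Standing assumptions: $H\in C^2(\mathbb{R}^d\times\mathbb{R}^d)$ and $G\in C^2(\mathbb{R}^d)$ have uniformly bounded second derivatives; $H=H(x,p)$ is convex in its second variable $p$ and $H(x,p)=\sup_{v\in\mathbb{R}^d}\{p\cdot v-L(x,-v)\}$ for some (real-valued) $L\in C^2(\mathbb{R}^d\times\mathbb{R}^d)$ that is convex in its second variable. Notation: $\partial_x$ is the gradient in $x$; $\partial_{xx}H,\partial_{xp}H,\partial_{pp}H$ are the $d\times d$ blocks of second derivatives of $H$; $\partial_{xx}G$ is the Hessian of $G$. For a square matrix $A$, $\mathrm{Re}\,A:=\frac12(A+A^\top)$. For a symmetric matrix $A$, $\lambda_{\min}(A)$ and $\lambda_{\max}(A)$ are its smallest and largest eigenvalues. $\|\partial_{pp}H\|_\infty$ is the supremum over $(x,p)$ of the operator norm of $\partial_{pp}H(x,p)$. "Globally well-posed in the class $C^{1,1}_{\mathrm{loc}}([0,T]\times\mathbb{R}^d)$" means that the terminal value problem has a unique classical solution $u\in C^{1,1}_{\mathrm{loc}}([0,T]\times\mathbb{R}^d)$, i.e. a unique function $u$ that is $C^1$ with locally Lipschitz first derivatives on $[0,T]\times\mathbb{R}^d$, satisfies the equation pointwise, and satisfies the terminal condition. *)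

theory Defs
  imports "HOL-Analysis.Analysis"
begin

definition gradient :: "('a::real_inner \<Rightarrow> real) \<Rightarrow> 'a \<Rightarrow> 'a" where
  "gradient f x = (THE D. GDERIV f x :> D)"

lemma gradient_eqI: "GDERIV f x :> D \<Longrightarrow> gradient f x = D"
  unfolding gradient_def
proof (rule the_equality)
  fix D' assume "GDERIV f x :> D" and "GDERIV f x :> D'"
  then have "(\<lambda>h. h \<bullet> D') = (\<lambda>h. h \<bullet> D)"
    unfolding gderiv_def by (rule has_derivative_unique[rotated])
  then have "\<forall>h. h \<bullet> D' = h \<bullet> D"
    by (simp add: fun_eq_iff)
  then show "D' = D"
    by (simp only: vector_eq_ldot)
qed

(* On a Euclidean space, continuity of the second derivative is the same as
   continuity of its value in each fixed direction. *)
definition C2 :: "('a::euclidean_space \<Rightarrow> real) \<Rightarrow> bool" where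
  "C2 f \<longleftrightarrow>
     (\<forall>x. f differentiable (at x)) \<and>
     (\<forall>x. gradient f differentiable (at x)) \<and>
     (\<forall>h. continuous_on UNIV (\<lambda>x. frechet_derivative (gradient f) (at x) h))"

definition bounded_second_derivatives :: "('a::euclidean_space \<Rightarrow> real) \<Rightarrow> bool" where
  "bounded_second_derivatives f \<longleftrightarrow>
     (\<exists>C. \<forall>x. onorm (frechet_derivative (gradient f) (at x)) \<le> C)"

definition hessian :: "(real^'n \<Rightarrow> real) \<Rightarrow> real^'n \<Rightarrow> real^'n^'n" where
  "hessian f x = jacobian (gradient f) (at x)"

definition D_xx :: "((real^'n) \<times> (real^'n) \<Rightarrow> real) \<Rightarrow> real^'n \<Rightarrow> real^'n \<Rightarrow> real^'n^'n" where
  "D_xx H x p = hessian (\<lambda>y. H (y, p)) x"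

definition D_pp :: "((real^'n) \<times> (real^'n) \<Rightarrow> real) \<Rightarrow> real^'n \<Rightarrow> real^'n \<Rightarrow> real^'n^'n" where
  "D_pp H x p = hessian (\<lambda>q. H (x, q)) p"

(* The (i,j) entry is the derivative in p_j of the derivative of H in x_i. *)
definition D_xp :: "((real^'n) \<times> (real^'n) \<Rightarrow> real) \<Rightarrow> real^'n \<Rightarrow> real^'n \<Rightarrow> real^'n^'n" where
  "D_xp H x p = jacobian (\<lambda>q. gradient (\<lambda>y. H (y, q)) x) (at p)"

definition Re_mat :: "real^'n^'n \<Rightarrow> real^'n^'n" where
  "Re_mat A = (1/2) *\<^sub>R (A + transpose A)"

definition eigenvalues :: "real^'n^'n \<Rightarrow> real set" where
  "eigenvalues A = {k. \<exists>v. v \<noteq> 0 \<and> A *v v = k *\<^sub>R v}"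

(* Only meaningful for symmetric matrices, whose set of real eigenvalues is
   finite and nonempty. *)
definition lambda_min :: "real^'n^'n \<Rightarrow> real" where
  "lambda_min A = Min (eigenvalues A)"

definition lambda_max :: "real^'n^'n \<Rightarrow> real" where
  "lambda_max A = Max (eigenvalues A)"

(* The infima and suprema below are taken in the reals; they are over bounded
   sets as soon as the second derivatives of H and G are bounded. *)
definition lambda_0 :: "((real^'n) \<times> (real^'n) \<Rightarrow> real) \<Rightarrow> real" where
  "lambda_0 H = (INF (x, p)\<in>UNIV. lambda_min (Re_mat (D_xp H x p)))"

definition lambda_H :: "((real^'n) \<times> (real^'n) \<Rightarrow> real) \<Rightarrow> real" where
  "lambda_H H = (SUP (x, p)\<in>UNIV. lambda_max (D_xx H x p))"

definition lambda_G :: "(real^'n \<Rightarrow> real) \<Rightarrow> real" where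
  "lambda_G G = (INF x. lambda_min (hessian G x))"

definition D_pp_sup_norm :: "((real^'n) \<times> (real^'n) \<Rightarrow> real) \<Rightarrow> real" where
  "D_pp_sup_norm H = (SUP (x, p)\<in>UNIV. onorm (\<lambda>v. D_pp H x p *v v))"

definition locally_lipschitz_on ::
    "'a::metric_space set \<Rightarrow> ('a \<Rightarrow> 'b::metric_space) \<Rightarrow> bool" where
  "locally_lipschitz_on S f \<longleftrightarrow>
     (\<forall>z\<in>S. \<exists>r>0. \<exists>C. C-lipschitz_on (S \<inter> cball z r) f)"

(* C^1 on S with locally Lipschitz first derivatives. Derivatives are taken within S,
   hence one-sided at boundary points such as t = 0 and t = T below, and the local
   Lipschitz property holds up to the boundary. *)
definition C11_loc_on :: "'a::euclidean_space set \<Rightarrow> ('a \<Rightarrow> real) \<Rightarrow> bool" where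
  "C11_loc_on S u \<longleftrightarrow>
     (\<exists>Du. (\<forall>z\<in>S. (u has_derivative (\<lambda>h. h \<bullet> Du z)) (at z within S)) \<and>
           locally_lipschitz_on S Du)"

definition HJ_solution ::
    "((real^'n) \<times> (real^'n) \<Rightarrow> real) \<Rightarrow> (real^'n \<Rightarrow> real) \<Rightarrow> real \<Rightarrow>
     (real \<times> (real^'n) \<Rightarrow> real) \<Rightarrow> bool" where
  "HJ_solution H G T u \<longleftrightarrow>
     C11_loc_on ({0..T} \<times> UNIV) u \<and>
     (\<forall>t\<in>{0<..<T}. \<forall>x.
        - deriv (\<lambda>s. u (s, x)) t + H (x, gradient (\<lambda>y. u (t, y)) x) = 0) \<and>
     (\<forall>x. u (T, x) = G x)"

(* Uniqueness is as functions on [0,T] x R^d: values for other times are irrelevant. *)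
definition HJ_well_posed ::
    "((real^'n) \<times> (real^'n) \<Rightarrow> real) \<Rightarrow> (real^'n \<Rightarrow> real) \<Rightarrow> real \<Rightarrow> bool" where
  "HJ_well_posed H G T \<longleftrightarrow>
     (\<exists>u. HJ_solution H G T u) \<and>
     (\<forall>u v. HJ_solution H G T u \<longrightarrow> HJ_solution H G T v \<longrightarrow>
        (\<forall>z\<in>{0..T} \<times> UNIV. u z = v z))"

end

theory Submission
  imports Defs
begin

text \<open>
  The solution is built by the method of characteristics, and the spectral hypotheses are exactly
  what prevents the characteristics from crossing. Write \<open>X' = - H\<^sub>p(X, P)\<close>, \<open>P' = H\<^sub>x(X, P)\<close> with
  terminal data \<open>X(T) = x\<close>, \<open>P(T) = DG(x)\<close>. The vector field is globally Lipschitz, so every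
  characteristic exists on the whole of \<open>[0, T]\<close>.

  For two characteristics with differences \<open>\<xi>\<close> of positions and \<open>\<eta>\<close> of momenta, consider
  \<open>m\<^sub>d = \<eta> \<bullet> \<xi> - d |\<xi>|\<^sup>2\<close> for a constant \<open>d \<le> 0\<close>. In the derivative of \<open>m\<^sub>d\<close> the mixed second
  derivatives of \<open>H\<close> cancel up to a multiple of \<open>d\<close>, and completing the square in the direction of
  \<open>H\<^sub>p\<^sub>p \<ge> 0\<close> gives \<open>- m\<^sub>d' \<ge> (- \<lambda>\<^sub>H - 2 d \<lambda>\<^sub>0 - d\<^sup>2 M) |\<xi>|\<^sup>2\<close>, where \<open>M\<close> is the supremum
  of the norms of \<open>H\<^sub>p\<^sub>p\<close> (\<open>hamiltonian_gradient_monotone\<close>). The hypotheses say that the lower root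
  \<open>c = - (\<lambda>\<^sub>0 + sqrt (\<lambda>\<^sub>0\<^sup>2 - M \<lambda>\<^sub>H)) / M\<close> of this quadratic satisfies \<open>c \<le> 0\<close> and \<open>c \<le> \<lambda>\<^sub>G\<close>
  (\<open>nonpositive_riccati_root\<close>). Hence \<open>m\<^sub>c\<close> is nonincreasing in time and nonnegative at \<open>T\<close>, so it is
  nonnegative throughout; this is a lower bound for the Hessian of the solution, in a form which
  makes sense for differences. The same computation with \<open>c - 1\<close> in place of \<open>c\<close> shows that
  \<open>m\<^sub>c\<^sub>-\<^sub>1 = m\<^sub>c + |\<xi>|\<^sup>2\<close> grows at most exponentially in time. As \<open>m\<^sub>c\<^sub>-\<^sub>1\<close> dominates \<open>|\<xi>|\<^sup>2\<close> at \<open>T\<close>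
  and is at most a multiple of \<open>|\<xi>(T)| |\<xi>(t)|\<close> at \<open>t\<close>, one gets \<open>|\<xi>(T)| \<le> const |\<xi>(t)|\<close>
  (\<open>X_expanding\<close>). So \<open>x \<mapsto> X(t)\<close> is bi-Lipschitz, and onto by invariance of domain (\<open>X_bij\<close>).

  The value \<open>W\<close> transported along a characteristic solves \<open>W' = H - P \<bullet> H\<^sub>p\<close>, \<open>W(T) = G(x)\<close>. Comparing two
  characteristics, \<open>W\<^sub>2 - W\<^sub>1 - P\<^sub>1 \<bullet> (X\<^sub>2 - X\<^sub>1)\<close> is of second order in \<open>X\<^sub>2 - X\<^sub>1\<close> (\<open>W_remainder\<close>), which
  identifies \<open>P\<close> as the spatial gradient of the function \<open>u(t, X(t)) = W(t)\<close> without differentiating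
  the flow in \<open>x\<close>. Together with the Lipschitz bounds this makes \<open>u\<close> a solution of class \<open>C\<^sup>1\<^sup>,\<^sup>1\<close>.

  Uniqueness needs no growth condition. For an arbitrary solution \<open>v\<close> and a point \<open>(t\<^sub>0, y\<^sub>0)\<close>, solve the
  characteristic system forward from \<open>(y\<^sub>0, Dv(t\<^sub>0, y\<^sub>0))\<close>; differentiating \<open>v\<close> along nearby parallel
  curves and a Gronwall argument show that \<open>P = Dv\<close> persists up to \<open>T\<close>
  (\<open>classical_solution_momentum\<close>). Thus the curve is one of the characteristics above, and \<open>v\<close> and
  \<open>W\<close> obey the same equation along it (\<open>classical_solution_eq_val\<close>).

  The constant \<open>M\<close> is positive: otherwise \<open>H(0, p)\<close> would be affine in \<open>p\<close>, whereas a supremum of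
  \<open>p \<bullet> v - L\<close> over all \<open>v\<close> with real-valued \<open>L\<close> grows faster than any linear function
  (\<open>D_pp_sup_norm_pos\<close>).
\<close>

section \<open>Gradients and second derivatives\<close>

lemma has_derivative_gradient:
  fixes f :: "'a::euclidean_space \<Rightarrow> real"
  assumes "f differentiable (at x)"
  shows "(f has_derivative (\<lambda>h. h \<bullet> gradient f x)) (at x)"
proof -
  obtain f' where f': "(f has_derivative f') (at x)"
    using assms by (auto simp: differentiable_def)
  define D where "D = (\<Sum>b\<in>Basis. f' b *\<^sub>R b)"
  have lin: "linear f'" using f' by (rule has_derivative_linear)
  have "f' h = h \<bullet> D" for h
  proof -
    have "f' h = f' (\<Sum>b\<in>Basis. (h \<bullet> b) *\<^sub>R b)" by (simp add: euclidean_representation)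
    also have "\<dots> = (\<Sum>b\<in>Basis. (h \<bullet> b) * f' b)"
      using lin by (simp add: linear_sum linear_scale)
    also have "\<dots> = h \<bullet> D" by (simp add: D_def inner_sum_right mult.commute)
    finally show ?thesis .
  qed
  then have "f' = (\<lambda>h. h \<bullet> D)" by (rule ext)
  then have "GDERIV f x :> D" using f' by (simp add: gderiv_def)
  then show ?thesis using gradient_eqI[of f x D] by (simp add: gderiv_def)
qed

lemma C2_gradient:
  assumes "C2 f"
  shows "(f has_derivative (\<lambda>h. h \<bullet> gradient f x)) (at x)"
    and "(gradient f has_derivative frechet_derivative (gradient f) (at x)) (at x)"
  using assms has_derivative_gradient frechet_derivative_works unfolding C2_def by blast+

lemma gradient_lipschitz:
  assumes "C2 f" "bounded_second_derivatives f"
  shows "\<exists>K\<ge>0. (\<forall>x. onorm (frechet_derivative (gradient f) (at x)) \<le> K) \<and>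
    (\<forall>x y. norm (gradient f x - gradient f y) \<le> K * norm (x - y))"
proof -
  obtain K where K: "\<And>x. onorm (frechet_derivative (gradient f) (at x)) \<le> K"
    using assms(2) by (auto simp: bounded_second_derivatives_def)
  have D: "(gradient f has_derivative frechet_derivative (gradient f) (at x)) (at x)" for x
    using C2_gradient(2)[OF assms(1)] .
  have "0 \<le> K"
    using onorm_pos_le[OF has_derivative_bounded_linear[OF D[of 0]]] K[of 0] by linarith
  moreover have "norm (gradient f x - gradient f y) \<le> K * norm (x - y)" for x y
    by (rule differentiable_bound[where S=UNIV and f'="\<lambda>x. frechet_derivative (gradient f) (at x)"])
      (use D K in auto)
  ultimately show ?thesis using K by blast
qed

text \<open>The Lipschitz estimate of the gradient is only assumed relative to the base point of the segment, so
  that the bound also applies to functions whose gradient is locally Lipschitz.\<close>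

lemma first_order_remainder:
  fixes f :: "'a::real_inner \<Rightarrow> real"
  assumes f: "\<And>z. z \<in> closed_segment x y \<Longrightarrow> (f has_derivative (\<lambda>h. h \<bullet> g z)) (at z)"
    and g: "\<And>z. z \<in> closed_segment x y \<Longrightarrow> norm (g z - g x) \<le> K * norm (z - x)"
    and K: "0 \<le> K"
  shows "\<bar>f y - f x - (y - x) \<bullet> g x\<bar> \<le> K * (norm (y - x))\<^sup>2"
proof -
  have "norm ((f y - y \<bullet> g x) - (f x - x \<bullet> g x)) \<le> (K * norm (y - x)) * norm (y - x)"
  proof (rule differentiable_bound[where S="closed_segment x y"
        and f'="\<lambda>z h. h \<bullet> (g z - g x)"])
    fix z assume z: "z \<in> closed_segment x y"
    have "((\<lambda>z. f z - z \<bullet> g x) has_derivative (\<lambda>h. h \<bullet> g z - h \<bullet> g x)) (at z)"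
      by (intro derivative_intros f z)
    then show "((\<lambda>z. f z - z \<bullet> g x) has_derivative (\<lambda>h. h \<bullet> (g z - g x)))
        (at z within closed_segment x y)"
      by (simp add: inner_diff_right has_derivative_at_withinI)
    have "norm (z - x) \<le> norm (y - x)"
      using z by (metis norm_minus_commute segment_bound(1))
    then have "norm (g z - g x) \<le> K * norm (y - x)"
      using g[OF z] K by (meson mult_left_mono order_trans)
    moreover have "onorm (\<lambda>h. h \<bullet> (g z - g x)) \<le> norm (g z - g x)"
      by (rule onorm_bound) (auto simp: mult.commute Cauchy_Schwarz_ineq2)
    ultimately show "onorm (\<lambda>h. h \<bullet> (g z - g x)) \<le> K * norm (y - x)" by linarith
  qed auto
  then show ?thesis by (simp add: power2_eq_square inner_diff_left algebra_simps)
qed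

text \<open>Both sides are the limit of the same second difference divided by \<open>t\<^sup>2\<close>, because that difference does not
  change when \<open>h\<close> and \<open>k\<close> are exchanged; the mean value theorem is applied in the direction \<open>h\<close>.\<close>

lemma second_derivative_symmetric:
  fixes f :: "'a::euclidean_space \<Rightarrow> real"
  assumes f: "\<And>x. (f has_derivative (\<lambda>h. h \<bullet> g x)) (at x)"
    and g: "(g has_derivative A) (at x)"
  shows "A h \<bullet> k = A k \<bullet> h"
proof -
  have lin: "linear A" using g by (rule has_derivative_linear)
  define S where "S h k t = (f (x + t *\<^sub>R h + t *\<^sub>R k) - f (x + t *\<^sub>R h) - f (x + t *\<^sub>R k) + f x)" for h k and t::real
  have lim: "((\<lambda>t. S h k t / t\<^sup>2) \<longlongrightarrow> A k \<bullet> h) (at_right 0)" for h k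
  proof (rule tendstoI)
    fix e :: real assume e: "e > 0"
    define N where "N = norm h + norm k + 1"
    have N: "N > 0" by (simp add: N_def add_nonneg_pos)
    define e' where "e' = e / (4 * N\<^sup>2)"
    have e': "e' > 0" using e N by (simp add: e'_def)
    obtain d where d: "d > 0" "\<And>y. norm (y - x) < d \<Longrightarrow> norm (g y - g x - A (y - x)) \<le> e' * norm (y - x)"
      using g e' unfolding has_derivative_at_alt by blast
    have "eventually (\<lambda>t. t \<in> {0<..<d / N}) (at_right 0)"
      using d N by (intro eventually_at_right_real) auto
    then show "eventually (\<lambda>t. dist (S h k t / t\<^sup>2) (A k \<bullet> h) < e) (at_right 0)"
    proof eventually_elim
      case (elim t)
      then have t: "0 < t" "t * N < d" using N by (auto simp: field_simps)
      define \<phi> where "\<phi> s = f (x + s *\<^sub>R h + t *\<^sub>R k) - f (x + s *\<^sub>R h)" for s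
      have "(\<phi> has_derivative (\<lambda>r. (r *\<^sub>R h) \<bullet> g (x + s *\<^sub>R h + t *\<^sub>R k) - (r *\<^sub>R h) \<bullet> g (x + s *\<^sub>R h))) (at s)" for s
        unfolding \<phi>_def
        by (rule has_derivative_diff; rule has_derivative_compose[OF _ f])
          (auto intro!: derivative_eq_intros)
      then have D: "DERIV \<phi> s :> h \<bullet> (g (x + s *\<^sub>R h + t *\<^sub>R k) - g (x + s *\<^sub>R h))" for s
        unfolding has_field_derivative_def
        by (rule has_derivative_eq_rhs) (auto simp: algebra_simps inner_diff_right)
      obtain s where s: "0 < s" "s < t" "\<phi> t - \<phi> 0 = t * (h \<bullet> (g (x + s *\<^sub>R h + t *\<^sub>R k) - g (x + s *\<^sub>R h)))"
        using MVT2[of 0 t \<phi>, OF t(1) D] by auto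
      define y1 where "y1 = x + s *\<^sub>R h + t *\<^sub>R k"
      define y2 where "y2 = x + s *\<^sub>R h"
      have "norm (y1 - x) \<le> s * norm h + t * norm k"
        unfolding y1_def using s t by (simp add: norm_triangle_le add.assoc)
      also have "\<dots> \<le> t * norm h + t * norm k" using s by (simp add: mult_right_mono)
      also have "\<dots> \<le> t * N" using t by (simp add: N_def algebra_simps)
      finally have n1: "norm (y1 - x) \<le> t * N" .
      have "norm (y2 - x) \<le> t * norm h" unfolding y2_def using s by (simp add: mult_right_mono)
      also have "\<dots> \<le> t * N" using t by (intro mult_left_mono) (auto simp: N_def)
      finally have n2: "norm (y2 - x) \<le> t * N" .
      have b1: "norm (g y1 - g x - A (y1 - x)) \<le> e' * (t * N)"
        using d(2)[of y1] n1 t e' by (smt (verit) mult_left_mono)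
      have b2: "norm (g y2 - g x - A (y2 - x)) \<le> e' * (t * N)"
        using d(2)[of y2] n2 t e' by (smt (verit) mult_left_mono)
      have "A (y1 - x) - A (y2 - x) = A (t *\<^sub>R k)"
        by (simp add: y1_def y2_def flip: linear_diff[OF lin])
      then have Ak: "A (y1 - x) - A (y2 - x) = t *\<^sub>R A k" by (simp add: linear_scale[OF lin])
      have eq: "g y1 - g y2 - t *\<^sub>R A k
          = (g y1 - g x - A (y1 - x)) - (g y2 - g x - A (y2 - x))"
        unfolding Ak[symmetric] by simp
      have b: "norm (g y1 - g y2 - t *\<^sub>R A k) \<le> 2 * (e' * (t * N))"
        unfolding eq using norm_triangle_ineq4[of "g y1 - g x - A (y1 - x)" "g y2 - g x - A (y2 - x)"] b1 b2
        by linarith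
      have "\<phi> t - \<phi> 0 = S h k t" by (simp add: \<phi>_def S_def)
      then have "S h k t - t\<^sup>2 * (A k \<bullet> h) = t * (h \<bullet> (g y1 - g y2 - t *\<^sub>R A k))"
        using s(3) by (simp add: y1_def y2_def inner_diff_right inner_commute power2_eq_square algebra_simps)
      then have "S h k t / t\<^sup>2 - A k \<bullet> h = (h \<bullet> (g y1 - g y2 - t *\<^sub>R A k)) / t"
        using t by (simp add: field_simps power2_eq_square)
      also have "\<bar>\<dots>\<bar> \<le> norm h * (2 * (e' * (t * N))) / t"
      proof -
        have "\<bar>h \<bullet> (g y1 - g y2 - t *\<^sub>R A k)\<bar> \<le> norm h * (2 * (e' * (t * N)))"
          by (rule order_trans[OF Cauchy_Schwarz_ineq2 mult_left_mono[OF b]]) simp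
        from divide_right_mono[OF this, of t] t show ?thesis by simp
      qed
      also have "\<dots> = 2 * e' * norm h * N" using t by simp
      also have "\<dots> \<le> 2 * e' * N * N" using e' N by (intro mult_right_mono mult_left_mono) (auto simp: N_def)
      also have "\<dots> = e / 2" using N by (simp add: e'_def power2_eq_square)
      finally show ?case using e by (simp add: dist_real_def)
    qed
  qed
  have "S h k = S k h" by (auto simp: S_def algebra_simps)
  then show ?thesis
    using tendsto_unique[OF _ lim[of h k]] lim[of k h] trivial_limit_at_right_real by (metis)
qed

section \<open>Ordinary differential equations with a Lipschitz right-hand side\<close>

lemma has_integral_exp:
  fixes l t :: real
  assumes "l > 0" "0 \<le> t"
  shows "((\<lambda>s. exp (l * s)) has_integral (exp (l * t) - 1) / l) {0..t}"
proof -
  have "((\<lambda>s. exp (l * s)) has_integral (exp (l * t) / l - exp (l * 0) / l)) {0..t}"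
    using assms by (intro fundamental_theorem_of_calculus)
      (auto intro!: derivative_eq_intros simp flip: has_real_derivative_iff_has_vector_derivative)
  then show ?thesis by (simp add: diff_divide_distrib)
qed

text \<open>Picard iteration in the norm weighted by \<open>exp (- l * t)\<close> with \<open>l > 2 K\<close>: the weight makes the integral
  operator a contraction on the whole interval, so that no gluing of short-time solutions is needed.
  The unknown is the weighted function \<open>exp (- l * t) z(t)\<close>, extended to the real line by constants.\<close>

lemma lipschitz_ode_solvable:
  fixes F :: "'a::banach \<Rightarrow> 'a"
  assumes F: "\<And>x y. norm (F x - F y) \<le> K * norm (x - y)" and K: "0 \<le> K" and T: "0 \<le> T"
  obtains z where "z 0 = z0"
    and "\<And>t. t \<in> {0..T} \<Longrightarrow> (z has_vector_derivative F (z t)) (at t within {0..T})"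
proof -
  define l where "l = 2 * K + 1"
  have l: "l > 0" "K / l \<le> 1 / 2" using K by (auto simp: l_def field_simps)
  have contF: "continuous_on UNIV F"
    by (rule lipschitz_on_continuous_on[of K]) (use F K in \<open>auto intro!: lipschitz_onI simp: dist_norm\<close>)
  define cl where "cl t = max 0 (min T t)" for t :: real
  have cl: "cl t \<in> {0..T}" for t using T by (auto simp: cl_def)
  have cl_id: "cl t = t" if "t \<in> {0..T}" for t using that by (auto simp: cl_def)
  have contcl: "continuous_on A cl" for A unfolding cl_def by (intro continuous_intros)
  define I where "I y t = z0 + integral {0..t} (\<lambda>s. F (exp (l * s) *\<^sub>R apply_bcontfun y s))" for y t
  have contint: "continuous_on A (\<lambda>s. F (exp (l * s) *\<^sub>R apply_bcontfun y s))" for y A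
    by (rule continuous_on_compose2[OF contF]) (auto intro!: continuous_intros)
  have contI: "continuous_on {0..T} (\<lambda>t. exp (- l * t) *\<^sub>R I y t)" for y
    unfolding I_def
    by (intro continuous_intros indefinite_integral_continuous_1 integrable_continuous_real contint)
  define f where "f y t = exp (- l * cl t) *\<^sub>R I y (cl t)" for y t
  have fb: "f y \<in> bcontfun" for y
  proof -
    have "continuous_on UNIV (f y)" unfolding f_def
      by (rule continuous_on_compose2[OF contI contcl]) (use cl in auto)
    moreover have "bounded (range (f y))"
      using bounded_subset[OF compact_imp_bounded[OF compact_continuous_image[OF contI[of y] compact_Icc]], of "range (f y)"]
        cl unfolding f_def by blast
    ultimately show ?thesis by (simp add: bcontfun_def)
  qed
  define \<Phi> where "\<Phi> y = Bcontfun (f y)" for y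
  have ap: "apply_bcontfun (\<Phi> y) = f y" for y
    unfolding \<Phi>_def using fb by (rule Bcontfun_inverse)
  \<comment> \<open>integrating \<open>K exp (l * s)\<close> gains the factor \<open>K / l\<close>\<close>
  have contr: "dist (\<Phi> y1) (\<Phi> y2) \<le> 1 / 2 * dist y1 y2" for y1 y2
  proof (rule dist_bound)
    fix t
    define s where "s = cl t"
    define d where "d = dist y1 y2"
    have s: "0 \<le> s" using cl[of t] by (simp add: s_def)
    have d: "d \<ge> 0" by (simp add: d_def)
    let ?i = "\<lambda>y s. F (exp (l * s) *\<^sub>R apply_bcontfun y s)"
    have "I y1 s - I y2 s = integral {0..s} (\<lambda>r. ?i y1 r - ?i y2 r)"
      unfolding I_def by (simp add: integral_diff integrable_continuous_real contint)
    also have "norm \<dots> \<le> integral {0..s} (\<lambda>r. (K * d) * exp (l * r))"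
    proof (rule integral_norm_bound_integral)
      show "(\<lambda>r. ?i y1 r - ?i y2 r) integrable_on {0..s}"
        by (intro integrable_continuous_real continuous_intros contint)
      show "(\<lambda>r. (K * d) * exp (l * r)) integrable_on {0..s}"
        by (intro integrable_continuous_real continuous_intros)
      fix r
      have "norm (?i y1 r - ?i y2 r) \<le> K * norm (exp (l * r) *\<^sub>R apply_bcontfun y1 r - exp (l * r) *\<^sub>R apply_bcontfun y2 r)"
        by (rule F)
      also have "\<dots> = K * (exp (l * r) * dist (apply_bcontfun y1 r) (apply_bcontfun y2 r))"
        by (simp add: dist_norm flip: scaleR_diff_right)
      also have "\<dots> \<le> K * (exp (l * r) * d)"
        using K by (intro mult_left_mono) (auto simp: d_def dist_bounded)
      finally show "norm (?i y1 r - ?i y2 r) \<le> (K * d) * exp (l * r)" by (simp add: mult_ac)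
    qed
    also have "\<dots> = (K * d) * ((exp (l * s) - 1) / l)"
      using integral_unique[OF has_integral_exp[OF l(1) s]] by simp
    also have "\<dots> = (K / l) * d * (exp (l * s) - 1)" by simp
    also have "\<dots> \<le> (1 / 2) * d * exp (l * s)"
      using l s d by (intro mult_mono) auto
    finally have "norm (I y1 s - I y2 s) \<le> (1 / 2) * d * exp (l * s)" .
    then have "exp (- l * s) * norm (I y1 s - I y2 s) \<le> exp (- l * s) * ((1 / 2) * d * exp (l * s))"
      by (intro mult_left_mono) auto
    also have "\<dots> = 1 / 2 * d" by (simp add: exp_minus)
    finally show "dist (apply_bcontfun (\<Phi> y1) t) (apply_bcontfun (\<Phi> y2) t) \<le> 1 / 2 * dist y1 y2"
      unfolding ap f_def s_def[symmetric] d_def[symmetric]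
      by (simp add: dist_norm flip: scaleR_diff_right)
  qed
  obtain y where y: "\<Phi> y = y"
    using banach_fix_type[of "1/2" \<Phi>] contr by auto
  define z where "z t = I y t" for t
  have yz: "exp (l * t) *\<^sub>R apply_bcontfun y t = z t" if "t \<in> {0..T}" for t
  proof -
    have "apply_bcontfun y t = f y t" using ap[of y] y by simp
    then show ?thesis by (simp add: f_def cl_id[OF that] z_def exp_minus)
  qed
  have "z 0 = z0" by (simp add: z_def I_def)
  moreover have "(z has_vector_derivative F (z t)) (at t within {0..T})" if t: "t \<in> {0..T}" for t
  proof -
    have "((\<lambda>u. z0 + integral {0..u} (\<lambda>s. F (exp (l * s) *\<^sub>R apply_bcontfun y s))) has_vector_derivative
        0 + F (exp (l * t) *\<^sub>R apply_bcontfun y t)) (at t within {0..T})"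
      by (intro has_vector_derivative_add has_vector_derivative_const integral_has_vector_derivative contint t)
    moreover have "z = (\<lambda>u. z0 + integral {0..u} (\<lambda>s. F (exp (l * s) *\<^sub>R apply_bcontfun y s)))"
      by (simp add: z_def I_def fun_eq_iff)
    ultimately show ?thesis by (simp add: yz[OF t])
  qed
  ultimately show ?thesis using that by blast
qed

lemma nonneg_derivative_imp_le:
  fixes f :: "real \<Rightarrow> real"
  assumes "a \<le> b" and cont: "continuous_on {a..b} f"
    and f: "\<And>t. t \<in> {a<..<b} \<Longrightarrow> (f has_vector_derivative f' t) (at t)"
    and f': "\<And>t. t \<in> {a<..<b} \<Longrightarrow> 0 \<le> f' t"
  shows "f a \<le> f b"
proof (rule DERIV_nonneg_imp_increasing_open[OF \<open>a \<le> b\<close> _ cont])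
  fix t assume "a < t" "t < b"
  then show "\<exists>y. DERIV f t :> y \<and> y \<ge> 0"
    using f f' by (auto simp: has_real_derivative_iff_has_vector_derivative)
qed

lemma derivative_bound_imp_le:
  fixes f g :: "real \<Rightarrow> real"
  assumes "a \<le> b" and cont: "continuous_on {a..b} f" "continuous_on {a..b} g"
    and f: "\<And>t. t \<in> {a<..<b} \<Longrightarrow> (f has_vector_derivative f' t) (at t)"
    and g: "\<And>t. t \<in> {a<..<b} \<Longrightarrow> (g has_vector_derivative g' t) (at t)"
    and le: "\<And>t. t \<in> {a<..<b} \<Longrightarrow> \<bar>f' t\<bar> \<le> g' t"
  shows "\<bar>f b - f a\<bar> \<le> g b - g a"
proof -
  have "g a - f a \<le> g b - f b"
  proof (rule nonneg_derivative_imp_le[where f'="\<lambda>t. g' t - f' t" and f="\<lambda>t. g t - f t", OF \<open>a \<le> b\<close>])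
    show "0 \<le> g' t - f' t" if "t \<in> {a<..<b}" for t using le[OF that] by linarith
  qed (intro continuous_intros cont has_vector_derivative_diff f g; assumption)+
  moreover have "g a + f a \<le> g b + f b"
  proof (rule nonneg_derivative_imp_le[where f'="\<lambda>t. g' t + f' t" and f="\<lambda>t. g t + f t", OF \<open>a \<le> b\<close>])
    show "0 \<le> g' t + f' t" if "t \<in> {a<..<b}" for t using le[OF that] by linarith
  qed (intro continuous_intros cont has_vector_derivative_add f g; assumption)+
  ultimately show ?thesis by linarith
qed

definition solves_ode :: "('a::real_normed_vector \<Rightarrow> 'a) \<Rightarrow> real \<Rightarrow> real \<Rightarrow> (real \<Rightarrow> 'a) \<Rightarrow> bool" where
  "solves_ode F a b z \<longleftrightarrow> (\<forall>t\<in>{a..b}. (z has_vector_derivative F (z t)) (at t within {a..b}))"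

lemma solves_ode_interior:
  assumes "solves_ode F a b z" "t \<in> {a<..<b}"
  shows "(z has_vector_derivative F (z t)) (at t)"
proof -
  have "(z has_vector_derivative F (z t)) (at t within {a..b})"
    using assms by (auto simp: solves_ode_def)
  moreover have "at t within {a..b} = at t" using assms(2) by (intro at_within_Icc_at) auto
  ultimately show ?thesis by simp
qed

lemma solves_ode_subinterval:
  assumes "solves_ode F a b z" "a \<le> a'" "b' \<le> b"
  shows "solves_ode F a' b' z"
  unfolding solves_ode_def
proof
  fix t assume t: "t \<in> {a'..b'}"
  have "(z has_vector_derivative F (z t)) (at t within {a..b})"
    using assms t by (auto simp: solves_ode_def)
  then show "(z has_vector_derivative F (z t)) (at t within {a'..b'})"
    by (rule has_vector_derivative_within_subset) (use assms(2,3) in auto)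
qed

lemma solves_ode_continuous:
  "solves_ode F a b z \<Longrightarrow> continuous_on {a..b} z"
  unfolding solves_ode_def continuous_on_eq_continuous_within
  using has_vector_derivative_continuous by blast

lemma lipschitz_ode_initial_value:
  fixes F :: "'a::banach \<Rightarrow> 'a"
  assumes F: "\<And>x y. norm (F x - F y) \<le> K * norm (x - y)" and K: "0 \<le> K" and ab: "a \<le> b"
  obtains z where "z a = z0" "solves_ode F a b z"
proof -
  obtain y where y: "y 0 = z0"
    and D: "\<And>t. t \<in> {0..b - a} \<Longrightarrow> (y has_vector_derivative F (y t)) (at t within {0..b - a})"
    using lipschitz_ode_solvable[OF F K, of "b - a" z0] ab by auto
  have "((\<lambda>t. y (t - a)) has_vector_derivative F (y (t - a))) (at t within {a..b})"
    if t: "t \<in> {a..b}" for t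
  proof -
    have im: "(\<lambda>t. t - a) ` {a..b} = {0..b - a}" using ab by simp
    have "((\<lambda>t. t - a) has_vector_derivative 1) (at t within {a..b})"
      by (auto intro!: derivative_eq_intros)
    from vector_diff_chain_within[OF this, of y "F (y (t - a))"] D[of "t - a"] t
    show ?thesis unfolding im by (simp add: o_def)
  qed
  then show ?thesis using that[of "\<lambda>t. y (t - a)"] y by (simp add: solves_ode_def)
qed

lemma lipschitz_ode_terminal_value:
  fixes F :: "'a::banach \<Rightarrow> 'a"
  assumes F: "\<And>x y. norm (F x - F y) \<le> K * norm (x - y)" and K: "0 \<le> K" and ab: "a \<le> b"
  obtains z where "z b = z0" "solves_ode F a b z"
proof -
  have F': "norm (- F x - - F y) \<le> K * norm (x - y)" for x y
    using F[of x y] by (simp add: norm_minus_commute)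
  obtain y where y: "y 0 = z0"
    and D: "\<And>t. t \<in> {0..b - a} \<Longrightarrow> (y has_vector_derivative - F (y t)) (at t within {0..b - a})"
    using lipschitz_ode_solvable[OF F' K, of "b - a" z0] ab by auto
  have "((\<lambda>t. y (b - t)) has_vector_derivative F (y (b - t))) (at t within {a..b})"
    if t: "t \<in> {a..b}" for t
  proof -
    have im: "(\<lambda>t. b - t) ` {a..b} = {0..b - a}" using ab by simp
    have "((\<lambda>t. b - t) has_vector_derivative - 1) (at t within {a..b})"
      by (auto intro!: derivative_eq_intros)
    from vector_diff_chain_within[OF this, of y "- F (y (b - t))"] D[of "b - t"] t
    show ?thesis unfolding im by (simp add: o_def)
  qed
  then show ?thesis using that[of "\<lambda>t. y (b - t)"] y by (simp add: solves_ode_def)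
qed

lemma has_vector_derivative_inner:
  fixes f g :: "real \<Rightarrow> 'a::real_inner"
  assumes "(f has_vector_derivative f') (at t within S)" "(g has_vector_derivative g') (at t within S)"
  shows "((\<lambda>t. f t \<bullet> g t) has_vector_derivative (f t \<bullet> g' + f' \<bullet> g t)) (at t within S)"
  using bounded_bilinear.has_vector_derivative[OF bounded_bilinear_inner assms] .

text \<open>Gronwall's inequality backwards in time: \<open>exp (2 K s) |z - w|\<^sup>2\<close> is nondecreasing.\<close>

lemma lipschitz_ode_terminal_dependence:
  fixes F :: "'a::real_inner \<Rightarrow> 'a"
  assumes F: "\<And>x y. norm (F x - F y) \<le> K * norm (x - y)"
    and z: "solves_ode F a b z" and w: "solves_ode F a b w" and t: "t \<in> {a..b}"
  shows "norm (z t - w t) \<le> exp (K * (b - t)) * norm (z b - w b)"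
proof -
  define \<Delta> where "\<Delta> s = z s - w s" for s
  define f where "f s = exp (2 * K * s) * (\<Delta> s \<bullet> \<Delta> s)" for s
  have z': "solves_ode F t b z" and w': "solves_ode F t b w"
    using z w t by (auto elim: solves_ode_subinterval)
  have "f t \<le> f b"
  proof (rule nonneg_derivative_imp_le[where f=f and a=t and b=b and f'="\<lambda>s. exp (2 * K * s) * (2 * (K * (\<Delta> s \<bullet> \<Delta> s) + \<Delta> s \<bullet> (F (z s) - F (w s))))"])
    show "continuous_on {t..b} f" unfolding f_def \<Delta>_def
      by (intro continuous_intros solves_ode_continuous[OF z'] solves_ode_continuous[OF w'])
    fix s assume s: "s \<in> {t<..<b}"
    have d: "(\<Delta> has_vector_derivative F (z s) - F (w s)) (at s)" unfolding \<Delta>_def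
      by (intro has_vector_derivative_diff solves_ode_interior[OF z' s] solves_ode_interior[OF w' s])
    have e: "((\<lambda>s. exp (2 * K * s)) has_vector_derivative (2 * K * exp (2 * K * s))) (at s)"
      by (auto intro!: derivative_eq_intros simp flip: has_real_derivative_iff_has_vector_derivative)
    show "(f has_vector_derivative exp (2 * K * s) * (2 * (K * (\<Delta> s \<bullet> \<Delta> s) + \<Delta> s \<bullet> (F (z s) - F (w s))))) (at s)"
      unfolding f_def
      by (rule has_vector_derivative_eq_rhs[OF has_vector_derivative_mult[OF e has_vector_derivative_inner[OF d d]]])
        (simp add: inner_commute algebra_simps)
    have "\<bar>\<Delta> s \<bullet> (F (z s) - F (w s))\<bar> \<le> norm (\<Delta> s) * (K * norm (\<Delta> s))"
      by (rule order_trans[OF Cauchy_Schwarz_ineq2]) (simp add: \<Delta>_def F mult_left_mono)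
    also have "\<dots> = K * (\<Delta> s \<bullet> \<Delta> s)"
      by (simp add: dot_square_norm power2_eq_square)
    finally show "0 \<le> exp (2 * K * s) * (2 * (K * (\<Delta> s \<bullet> \<Delta> s) + \<Delta> s \<bullet> (F (z s) - F (w s))))"
      by (smt (verit) exp_gt_zero zero_le_mult_iff)
  qed (use t in auto)
  then have "(exp (K * t) * norm (\<Delta> t))\<^sup>2 \<le> (exp (K * b) * norm (\<Delta> b))\<^sup>2"
    by (simp add: f_def dot_square_norm power_mult_distrib mult.assoc flip: exp_double)
  then have "exp (K * t) * norm (\<Delta> t) \<le> exp (K * b) * norm (\<Delta> b)"
    by (rule power2_le_imp_le) simp
  then have "exp (- K * t) * (exp (K * t) * norm (\<Delta> t)) \<le> exp (- K * t) * (exp (K * b) * norm (\<Delta> b))"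
    by (intro mult_left_mono) auto
  then show ?thesis by (simp add: \<Delta>_def exp_diff exp_minus right_diff_distrib field_simps)
qed

section \<open>The flow of characteristics\<close>

lemma norm_snd_le_norm: "norm (snd z) \<le> norm z"
  by (cases z) (simp add: norm_snd_le)

text \<open>Here \<open>a\<close> and \<open>b\<close> are meant to be the differences of \<open>H\<^sub>p\<close> and \<open>H\<^sub>x\<close> along two characteristics; the expression
  in parentheses is then the quadratic form of \<open>hamiltonian_gradient_monotone\<close>.\<close>

lemma semiconvexity_gap_deriv:
  fixes \<xi> \<eta> :: "real \<Rightarrow> 'a::real_inner"
  assumes \<xi>: "(\<xi> has_vector_derivative - a) (at t)" and \<eta>: "(\<eta> has_vector_derivative b) (at t)"
  shows "((\<lambda>t. \<eta> t \<bullet> \<xi> t - d * (norm (\<xi> t))\<^sup>2) has_vector_derivative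
    - (a \<bullet> (\<eta> t - (2 * d) *\<^sub>R \<xi> t) - b \<bullet> \<xi> t)) (at t)"
proof -
  have "((\<lambda>t. \<eta> t \<bullet> \<xi> t - d * (\<xi> t \<bullet> \<xi> t)) has_vector_derivative
     (\<eta> t \<bullet> (- a) + b \<bullet> \<xi> t) - d * (\<xi> t \<bullet> (- a) + (- a) \<bullet> \<xi> t)) (at t)"
    by (intro has_vector_derivative_diff has_vector_derivative_mult_right has_vector_derivative_inner \<xi> \<eta>)
  then show ?thesis
    by (simp add: dot_square_norm inner_diff_right inner_commute[of a] algebra_simps)
qed

text \<open>
  The data of the characteristic system, with the two monotonicity estimates that the spectral
  hypotheses provide: the quantity \<open>\<eta> \<bullet> \<xi> - d |\<xi>|\<^sup>2\<close> is nonincreasing for \<open>d = c\<close> and grows at most at rate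
  \<open>C |\<xi>|\<^sup>2\<close> for \<open>d = c - 1\<close>. They are stated for pairs of points rather than for second derivatives, which
  is all that the comparison of two characteristics uses.
\<close>

locale monotone_hamiltonian =
  fixes H :: "'a::euclidean_space \<times> 'a \<Rightarrow> real" and DH :: "'a \<times> 'a \<Rightarrow> 'a \<times> 'a"
    and G :: "'a \<Rightarrow> real" and DG :: "'a \<Rightarrow> 'a"
    and K c C T :: real
  assumes K: "0 \<le> K" and C: "0 \<le> C" and T: "0 < T"
    and H: "(H has_derivative (\<lambda>h. h \<bullet> DH z)) (at z)"
    and DH: "norm (DH z - DH w) \<le> K * norm (z - w)"
    and G: "(G has_derivative (\<lambda>h. h \<bullet> DG x)) (at x)"
    and DG: "norm (DG x - DG y) \<le> K * norm (x - y)"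
    and DG_mono: "c * (norm (x - y))\<^sup>2 \<le> (DG x - DG y) \<bullet> (x - y)"
    and DH_mono: "0 \<le> (snd (DH z) - snd (DH w)) \<bullet> (snd z - snd w - (2 * c) *\<^sub>R (fst z - fst w))
          - (fst (DH z) - fst (DH w)) \<bullet> (fst z - fst w)"
    and DH_mono': "- C * (norm (fst z - fst w))\<^sup>2
        \<le> (snd (DH z) - snd (DH w)) \<bullet> (snd z - snd w - (2 * (c - 1)) *\<^sub>R (fst z - fst w))
          - (fst (DH z) - fst (DH w)) \<bullet> (fst z - fst w)"
begin

definition field :: "'a \<times> 'a \<Rightarrow> 'a \<times> 'a" where
  "field z = (- snd (DH z), fst (DH z))"

lemma field_lipschitz: "norm (field z - field w) \<le> K * norm (z - w)"
proof -
  have "norm (field z - field w) = norm (DH z - DH w)"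
    by (simp add: field_def norm_prod_def norm_minus_commute add.commute)
  then show ?thesis using DH[of z w] by simp
qed

lemma continuous_field: "continuous_on A field"
  by (rule lipschitz_on_continuous_on[of K])
    (use field_lipschitz K in \<open>auto intro!: lipschitz_onI simp: dist_norm\<close>)

definition charac :: "'a \<Rightarrow> real \<Rightarrow> 'a \<times> 'a" where
  "charac x = (SOME z. z T = (x, DG x) \<and> solves_ode field 0 T z)"

lemma charac: "charac x T = (x, DG x)" "solves_ode field 0 T (charac x)"
proof -
  obtain z where "z T = (x, DG x)" "solves_ode field 0 T z"
    using lipschitz_ode_terminal_value[OF field_lipschitz K, of 0 T "(x, DG x)"] T by auto
  then have "\<exists>z. z T = (x, DG x) \<and> solves_ode field 0 T z" by blast
  from someI_ex[OF this] have "charac x T = (x, DG x) \<and> solves_ode field 0 T (charac x)"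
    unfolding charac_def .
  then show "charac x T = (x, DG x)" "solves_ode field 0 T (charac x)" by auto
qed

definition X :: "'a \<Rightarrow> real \<Rightarrow> 'a" where "X x t = fst (charac x t)"
definition P :: "'a \<Rightarrow> real \<Rightarrow> 'a" where "P x t = snd (charac x t)"

lemma XP_T [simp]: "X x T = x" "P x T = DG x"
  by (simp_all add: X_def P_def charac)

lemma charac_eq: "charac x t = (X x t, P x t)"
  by (simp add: X_def P_def)

lemma solves_fieldD:
  assumes "(z has_vector_derivative field (z t)) (at t within S)"
  shows "((\<lambda>t. fst (z t)) has_vector_derivative - snd (DH (z t))) (at t within S)"
    and "((\<lambda>t. snd (z t)) has_vector_derivative fst (DH (z t))) (at t within S)"
  using bounded_linear.has_vector_derivative[OF bounded_linear_fst assms]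
    bounded_linear.has_vector_derivative[OF bounded_linear_snd assms]
  by (simp_all add: field_def)

lemma charac_deriv:
  "t \<in> {0..T} \<Longrightarrow> (charac x has_vector_derivative field (charac x t)) (at t within {0..T})"
  using charac(2) by (auto simp: solves_ode_def)

lemma XP_deriv:
  assumes "t \<in> {0..T}"
  shows "(X x has_vector_derivative - snd (DH (X x t, P x t))) (at t within {0..T})"
    and "(P x has_vector_derivative fst (DH (X x t, P x t))) (at t within {0..T})"
  using solves_fieldD[OF charac_deriv[OF assms, of x]]
  by (simp_all add: X_def[abs_def] P_def[abs_def])

lemma XP_deriv_interior:
  assumes "t \<in> {0<..<T}"
  shows "(X x has_vector_derivative - snd (DH (X x t, P x t))) (at t)"
    and "(P x has_vector_derivative fst (DH (X x t, P x t))) (at t)"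
  using XP_deriv[of t x] assms at_within_Icc_at[of 0 t T] by auto

lemma continuous_XP: "continuous_on {0..T} (X x)" "continuous_on {0..T} (P x)"
  using solves_ode_continuous[OF charac(2)[of x]] unfolding X_def[abs_def] P_def[abs_def]
  by (auto intro: continuous_intros)

definition flow_lip where "flow_lip = exp (K * T) * (1 + K)"

lemma flow_lip: "0 < flow_lip" using K by (simp add: flow_lip_def)

lemma charac_lipschitz:
  assumes t: "t \<in> {0..T}"
  shows "norm (charac x t - charac y t) \<le> flow_lip * norm (x - y)"
proof -
  have "norm (charac x t - charac y t) \<le> exp (K * (T - t)) * norm (charac x T - charac y T)"
    by (rule lipschitz_ode_terminal_dependence[OF field_lipschitz charac(2) charac(2) t])
  also have "\<dots> \<le> exp (K * T) * ((1 + K) * norm (x - y))"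
  proof (rule mult_mono)
    have "norm (charac x T - charac y T) \<le> norm (x - y) + norm (DG x - DG y)"
      by (simp add: charac norm_Pair_le)
    then show "norm (charac x T - charac y T) \<le> (1 + K) * norm (x - y)"
      using DG[of x y] by (simp add: algebra_simps)
    show "exp (K * (T - t)) \<le> exp (K * T)" using t K by (simp add: mult_left_mono)
  qed (use K in auto)
  finally show ?thesis by (simp add: flow_lip_def mult.assoc)
qed

lemma XP_lipschitz:
  assumes t: "t \<in> {0..T}"
  shows "norm (X x t - X y t) \<le> flow_lip * norm (x - y)" "norm (P x t - P y t) \<le> flow_lip * norm (x - y)"
  using charac_lipschitz[OF t, of x y] norm_fst_le[of "X x t - X y t" "P x t - P y t"]
    norm_snd_le[of "P x t - P y t" "X x t - X y t"]
  by (simp_all add: charac_eq)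

text \<open>Nonnegativity of \<open>mono_gap d\<close> for all pairs of characteristics says that the function whose gradient
  is \<open>P\<close> has Hessian at least \<open>d\<close>.\<close>

definition mono_gap :: "real \<Rightarrow> 'a \<Rightarrow> 'a \<Rightarrow> real \<Rightarrow> real" where
  "mono_gap d x y t = (P x t - P y t) \<bullet> (X x t - X y t) - d * (norm (X x t - X y t))\<^sup>2"

definition mono_rate :: "real \<Rightarrow> 'a \<Rightarrow> 'a \<Rightarrow> real \<Rightarrow> real" where
  "mono_rate d x y t =
    (snd (DH (X x t, P x t)) - snd (DH (X y t, P y t))) \<bullet> (P x t - P y t - (2 * d) *\<^sub>R (X x t - X y t))
    - (fst (DH (X x t, P x t)) - fst (DH (X y t, P y t))) \<bullet> (X x t - X y t)"

lemma mono_gap_deriv: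
  assumes "t \<in> {0<..<T}"
  shows "(mono_gap d x y has_vector_derivative - mono_rate d x y t) (at t)"
proof -
  have "((\<lambda>t. X x t - X y t) has_vector_derivative
      - (snd (DH (X x t, P x t)) - snd (DH (X y t, P y t)))) (at t)"
    using has_vector_derivative_diff[OF XP_deriv_interior(1)[OF assms, of x] XP_deriv_interior(1)[OF assms, of y]]
    by simp
  from semiconvexity_gap_deriv[OF this has_vector_derivative_diff[OF XP_deriv_interior(2)[OF assms, of x]
        XP_deriv_interior(2)[OF assms, of y]]]
  show ?thesis unfolding mono_gap_def[abs_def] mono_rate_def .
qed

lemma mono_gap_continuous: "continuous_on {0..T} (mono_gap d x y)"
  unfolding mono_gap_def by (intro continuous_intros continuous_XP)

lemma mono_gap_nonneg:
  assumes t: "t \<in> {0..T}"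
  shows "0 \<le> mono_gap c x y t"
proof -
  have "- mono_gap c x y t \<le> - mono_gap c x y T"
  proof (rule nonneg_derivative_imp_le[where f="\<lambda>t. - mono_gap c x y t" and a=t and b=T and f'="mono_rate c x y"])
    show "continuous_on {t..T} (\<lambda>t. - mono_gap c x y t)"
      using continuous_on_subset[OF mono_gap_continuous, of "{t..T}"] t by (intro continuous_intros) auto
    fix s assume s: "s \<in> {t<..<T}"
    show "((\<lambda>t. - mono_gap c x y t) has_vector_derivative mono_rate c x y s) (at s)"
      using has_vector_derivative_minus[OF mono_gap_deriv[of s c x y]] s t by auto
    show "0 \<le> mono_rate c x y s"
      using DH_mono[of "(X x s, P x s)" "(X y s, P y s)"] by (simp add: mono_rate_def)
  qed (use t in auto)
  moreover have "0 \<le> mono_gap c x y T" using DG_mono[of x y] by (simp add: mono_gap_def)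
  ultimately show ?thesis by linarith
qed

definition foot_lip where "foot_lip = exp (C * T) * flow_lip * (1 + \<bar>c - 1\<bar>)"

lemma foot_lip: "0 < foot_lip" using flow_lip by (simp add: foot_lip_def)

text \<open>The quantities for \<open>c - 1\<close> and \<open>c\<close> differ by \<open>|X x - X y|\<^sup>2\<close>, so nonnegativity for \<open>c\<close> makes the one for \<open>c - 1\<close>
  dominate this square. It grows at most exponentially in time, and at time \<open>t\<close> it carries a factor
  \<open>|X x t - X y t|\<close>; dividing by the other factor \<open>|x - y|\<close> gives the claim.\<close>

lemma X_expanding:
  assumes t: "t \<in> {0..T}"
  shows "norm (x - y) \<le> foot_lip * norm (X x t - X y t)"
proof -
  have gap: "mono_gap (c - 1) x y s = mono_gap c x y s + (norm (X x s - X y s))\<^sup>2" for s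
    by (simp add: mono_gap_def algebra_simps)
  define f where "f s = - exp (- C * s) * mono_gap (c - 1) x y s" for s
  define f' where "f' s = exp (- C * s) * (C * mono_gap (c - 1) x y s + mono_rate (c - 1) x y s)" for s
  have "f t \<le> f T"
  proof (rule nonneg_derivative_imp_le[where f=f and a=t and b=T and f'=f'])
    show "continuous_on {t..T} f" unfolding f_def
      using continuous_on_subset[OF mono_gap_continuous, of "{t..T}"] t by (intro continuous_intros) auto
    fix s assume s: "s \<in> {t<..<T}"
    then have s': "s \<in> {0<..<T}" "s \<in> {0..T}" using t by auto
    have e: "((\<lambda>s. - exp (- C * s)) has_vector_derivative (C * exp (- C * s))) (at s)"
      by (auto intro!: derivative_eq_intros simp flip: has_real_derivative_iff_has_vector_derivative)
    show "(f has_vector_derivative f' s) (at s)"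
      unfolding f_def
      by (rule has_vector_derivative_eq_rhs, rule has_vector_derivative_mult[OF e mono_gap_deriv[OF s'(1)]])
        (simp add: f'_def algebra_simps)
    have "C * (norm (X x s - X y s))\<^sup>2 \<le> C * mono_gap (c - 1) x y s"
      using mono_gap_nonneg[OF s'(2), of x y] C by (intro mult_left_mono) (auto simp: gap)
    then have "0 \<le> C * mono_gap (c - 1) x y s + mono_rate (c - 1) x y s"
      using DH_mono'[of "(X x s, P x s)" "(X y s, P y s)"] by (simp add: mono_rate_def)
    then show "0 \<le> f' s" by (simp add: f'_def)
  qed (use t in auto)
  then have "exp (C * T) * (exp (- C * T) * mono_gap (c - 1) x y T)
      \<le> exp (C * T) * (exp (- C * t) * mono_gap (c - 1) x y t)"
    unfolding f_def by (intro mult_left_mono) auto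
  then have *: "mono_gap (c - 1) x y T \<le> exp (C * (T - t)) * mono_gap (c - 1) x y t"
    by (simp add: exp_minus right_diff_distrib exp_diff field_simps)
  have "norm (x - y) * norm (x - y) \<le> mono_gap (c - 1) x y T"
    using mono_gap_nonneg[of T x y] T by (simp add: gap power2_eq_square)
  also note *
  also have "exp (C * (T - t)) * mono_gap (c - 1) x y t
      \<le> exp (C * T) * ((1 + \<bar>c - 1\<bar>) * (flow_lip * norm (x - y)) * norm (X x t - X y t))"
  proof (rule mult_mono)
    show "exp (C * (T - t)) \<le> exp (C * T)" using t C by (simp add: mult_left_mono)
    have "mono_gap (c - 1) x y t \<le> norm (P x t - P y t) * norm (X x t - X y t)
        + \<bar>c - 1\<bar> * (norm (X x t - X y t))\<^sup>2"
    proof -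
      have "- \<bar>c - 1\<bar> * (norm (X x t - X y t))\<^sup>2 \<le> (c - 1) * (norm (X x t - X y t))\<^sup>2"
        by (intro mult_right_mono) auto
      then show ?thesis
        using norm_cauchy_schwarz[of "P x t - P y t" "X x t - X y t"] unfolding mono_gap_def by linarith
    qed
    also have "\<dots> = (norm (P x t - P y t) + \<bar>c - 1\<bar> * norm (X x t - X y t)) * norm (X x t - X y t)"
      by (simp add: power2_eq_square algebra_simps)
    also have "\<dots> \<le> (flow_lip * norm (x - y) + \<bar>c - 1\<bar> * (flow_lip * norm (x - y))) * norm (X x t - X y t)"
      by (intro mult_right_mono add_mono mult_left_mono XP_lipschitz[OF t]) auto
    finally show "mono_gap (c - 1) x y t \<le> (1 + \<bar>c - 1\<bar>) * (flow_lip * norm (x - y)) * norm (X x t - X y t)"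
      by (simp add: algebra_simps)
    show "0 \<le> mono_gap (c - 1) x y t" using mono_gap_nonneg[OF t, of x y] by (simp add: gap)
  qed auto
  finally have "norm (x - y) * norm (x - y) \<le> norm (x - y) * (foot_lip * norm (X x t - X y t))"
    by (simp add: foot_lip_def mult_ac)
  then show ?thesis
    using foot_lip by (cases "x = y") (auto simp: mult_le_cancel_left_pos)
qed

text \<open>The image is open by invariance of domain and closed since the inverse is Lipschitz.\<close>

lemma X_bij:
  assumes t: "t \<in> {0..T}"
  shows "bij (\<lambda>x. X x t)"
proof -
  let ?f = "\<lambda>x. X x t"
  have inj: "inj ?f"
  proof (rule injI)
    fix x y assume "X x t = X y t"
    then have "norm (x - y) \<le> 0" using X_expanding[OF t, of x y] by simp
    then show "x = y" by simp
  qed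
  have cont: "continuous_on UNIV ?f"
    by (rule lipschitz_on_continuous_on[of flow_lip])
      (use XP_lipschitz(1)[OF t] flow_lip in \<open>auto intro!: lipschitz_onI simp: dist_norm\<close>)
  have "open (range ?f)"
    using invariance_of_domain[OF cont open_UNIV] inj by simp
  moreover have "closed (range ?f)"
    unfolding closed_sequential_limits
  proof (intro allI impI)
    fix y l assume yl: "(\<forall>n. y n \<in> range ?f) \<and> y \<longlonglongrightarrow> l"
    then have lim: "y \<longlonglongrightarrow> l" ..
    define x where "x n = inv ?f (y n)" for n
    have x: "y n = ?f (x n)" for n
      unfolding x_def by (rule f_inv_into_f[symmetric]) (use yl in simp)
    have "Cauchy x"
    proof (rule metric_CauchyI)
      fix e :: real assume "e > 0"
      then have "e / foot_lip > 0" using foot_lip by simp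
      then obtain M where M: "\<forall>m\<ge>M. \<forall>n\<ge>M. dist (y m) (y n) < e / foot_lip"
        using metric_CauchyD[OF LIMSEQ_imp_Cauchy[OF lim], of "e / foot_lip"] by (auto simp only:)
      have "dist (x m) (x n) < e" if "m \<ge> M" "n \<ge> M" for m n
      proof -
        have "dist (x m) (x n) \<le> foot_lip * dist (y m) (y n)"
          using X_expanding[OF t, of "x m" "x n"] by (simp add: dist_norm x)
        also have "\<dots> < e" using M that foot_lip by (simp add: pos_less_divide_eq mult.commute)
        finally show ?thesis .
      qed
      then show "\<exists>M. \<forall>m\<ge>M. \<forall>n\<ge>M. dist (x m) (x n) < e" by (intro exI[of _ M]) simp
    qed
    then have "convergent x" by (rule Cauchy_convergent)
    then obtain x0 where "x \<longlonglongrightarrow> x0" unfolding convergent_def by (rule exE)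
    with continuous_on_tendsto_compose[OF cont this] have "(\<lambda>n. ?f (x n)) \<longlonglongrightarrow> ?f x0"
      by simp
    then have "y \<longlonglongrightarrow> ?f x0" by (simp flip: x)
    then have "l = ?f x0" by (rule LIMSEQ_unique[OF lim])
    then show "l \<in> range ?f" by (rule range_eqI)
  qed
  ultimately have "range ?f = UNIV" using clopen[of "range ?f"] by auto
  then show ?thesis using inj by (simp add: bij_def)
qed

text \<open>The terminal position of the characteristic that passes through a given point at time \<open>t\<close>.\<close>

definition foot :: "real \<Rightarrow> 'a \<Rightarrow> 'a" where
  "foot t = inv (\<lambda>x. X x t)"

lemma X_foot [simp]: "t \<in> {0..T} \<Longrightarrow> X (foot t y) t = y"
  unfolding foot_def using bij_is_surj[OF X_bij] by (metis surj_f_inv_f)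

lemma foot_X [simp]: "t \<in> {0..T} \<Longrightarrow> foot t (X x t) = x"
  unfolding foot_def using bij_is_inj[OF X_bij] by (rule inv_f_f)

lemma foot_T [simp]: "foot T y = y"
  using foot_X[of T y] T by simp

section \<open>The value along characteristics\<close>

text \<open>The rate of change is the total derivative \<open>u\<^sub>t + Du \<bullet> X'\<close> that a solution \<open>u\<close> with \<open>Du = P\<close> must have along
  the characteristic.\<close>

definition W :: "'a \<Rightarrow> real \<Rightarrow> real" where
  "W x = (SOME w. w T = G x \<and> (\<forall>t\<in>{0..T}. (w has_vector_derivative
      H (X x t, P x t) - P x t \<bullet> snd (DH (X x t, P x t))) (at t within {0..T})))"

lemma continuous_H: "continuous_on A H"
  using H has_derivative_continuous continuous_at_imp_continuous_on by blast

lemma continuous_DH: "continuous_on A DH"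
  by (rule lipschitz_on_continuous_on[of K])
    (use DH K in \<open>auto intro!: lipschitz_onI simp: dist_norm\<close>)

lemma W: "W x T = G x"
  "t \<in> {0..T} \<Longrightarrow> (W x has_vector_derivative
      H (X x t, P x t) - P x t \<bullet> snd (DH (X x t, P x t))) (at t within {0..T})"
proof -
  let ?f = "\<lambda>t. H (X x t, P x t) - P x t \<bullet> snd (DH (X x t, P x t))"
  have "continuous_on {0..T} ?f"
    by (intro continuous_intros continuous_XP continuous_on_compose2[OF continuous_H[of UNIV]]
        continuous_on_compose2[OF continuous_DH[of UNIV]]) auto
  then obtain g where g: "\<And>t. t \<in> {0..T} \<Longrightarrow> (g has_vector_derivative ?f t) (at t within {0..T})"
    using antiderivative_continuous by blast
  have "((\<lambda>t. g t + (G x - g T)) has_vector_derivative ?f t) (at t within {0..T})" if "t \<in> {0..T}" for t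
    using has_vector_derivative_add[OF g[OF that] has_vector_derivative_const] by simp
  then have "\<exists>w. w T = G x \<and> (\<forall>t\<in>{0..T}. (w has_vector_derivative ?f t) (at t within {0..T}))"
    by (intro exI[of _ "\<lambda>t. g t + (G x - g T)"]) auto
  from someI_ex[OF this] show "W x T = G x"
    "t \<in> {0..T} \<Longrightarrow> (W x has_vector_derivative ?f t) (at t within {0..T})"
    unfolding W_def by auto
qed

lemma W_continuous: "continuous_on {0..T} (W x)"
  unfolding continuous_on_eq_continuous_within using W(2) has_vector_derivative_continuous by blast

lemma W_deriv_interior:
  assumes "t \<in> {0<..<T}"
  shows "(W x has_vector_derivative H (X x t, P x t) - P x t \<bullet> snd (DH (X x t, P x t))) (at t)"
  using W(2)[of t x] assms at_within_Icc_at[of 0 t T] by auto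

lemma H_remainder: "\<bar>H w - H z - (w - z) \<bullet> DH z\<bar> \<le> K * (norm (w - z))\<^sup>2"
  by (rule first_order_remainder) (use H DH K in auto)

lemma G_remainder: "\<bar>G y - G x - (y - x) \<bullet> DG x\<bar> \<le> K * (norm (y - x))\<^sup>2"
  by (rule first_order_remainder) (use G DG K in auto)

definition remainder_bound where "remainder_bound = (K + T * (2 * K * flow_lip\<^sup>2)) * foot_lip\<^sup>2"

lemma remainder_bound: "0 \<le> remainder_bound"
  using K T by (simp add: remainder_bound_def)

text \<open>At the terminal time the defect is the second-order remainder of \<open>G\<close>. Its time derivative is, up to sign, the
  second-order remainder of \<open>H\<close> plus a product of two differences, so it is of second order in the
  terminal distance as well; the expansion estimate turns this into the distance at time \<open>t\<close>.\<close>

lemma W_remainder: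
  assumes t: "t \<in> {0..T}"
  shows "\<bar>W y t - W x t - P x t \<bullet> (X y t - X x t)\<bar> \<le> remainder_bound * (norm (X y t - X x t))\<^sup>2"
proof -
  define f where "f s = W y s - W x s - P x s \<bullet> (X y s - X x s)" for s
  define f' where "f' s = (H (X y s, P y s) - P y s \<bullet> snd (DH (X y s, P y s)))
      - (H (X x s, P x s) - P x s \<bullet> snd (DH (X x s, P x s)))
      - (P x s \<bullet> (- snd (DH (X y s, P y s)) - - snd (DH (X x s, P x s)))
        + fst (DH (X x s, P x s)) \<bullet> (X y s - X x s))" for s
  define B where "B = 2 * K * flow_lip\<^sup>2 * (norm (y - x))\<^sup>2"
  have "\<bar>f T - f t\<bar> \<le> B * T - B * t"
  proof (rule derivative_bound_imp_le[where f=f and g="\<lambda>s. B * s" and a=t and b=T and f'=f' and g'="\<lambda>s. B"])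
    show "continuous_on {t..T} f" unfolding f_def
      using t by (intro continuous_intros continuous_on_subset[OF W_continuous]
          continuous_on_subset[OF continuous_XP(1)] continuous_on_subset[OF continuous_XP(2)]) auto
    fix s assume s: "s \<in> {t<..<T}"
    then have s': "s \<in> {0<..<T}" "s \<in> {0..T}" using t by auto
    show "(f has_vector_derivative f' s) (at s)"
      unfolding f_def f'_def
      by (intro has_vector_derivative_diff has_vector_derivative_inner XP_deriv_interior W_deriv_interior s')
    show "((\<lambda>s. B * s) has_vector_derivative B) (at s)"
      by (auto intro!: derivative_eq_intros simp flip: has_real_derivative_iff_has_vector_derivative)
    define z where "z = (X x s, P x s)"
    define w where "w = (X y s, P y s)"
    have n: "norm (w - z) \<le> flow_lip * norm (y - x)"
      using charac_lipschitz[OF s'(2), of y x] by (simp add: w_def z_def charac_eq)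
    have identity: "(h2 - p2 \<bullet> b2) - (h1 - p1 \<bullet> b1) - (p1 \<bullet> (- b2 - - b1) + a1 \<bullet> \<xi>)
        = (h2 - h1 - (\<xi> \<bullet> a1 + (p2 - p1) \<bullet> b1)) - (p2 - p1) \<bullet> (b2 - b1)"
      for h1 h2 :: real and p1 p2 a1 b1 b2 \<xi> :: 'a
      by (simp add: inner_diff_left inner_diff_right inner_commute[of \<xi>])
    have "f' s = (H w - H z - (w - z) \<bullet> DH z) - (P y s - P x s) \<bullet> (snd (DH w) - snd (DH z))"
      unfolding f'_def w_def z_def identity by (simp add: inner_prod_def)
    also have "\<bar>\<dots>\<bar> \<le> K * (norm (w - z))\<^sup>2 + norm (w - z) * (K * norm (w - z))"
    proof -
      have "\<bar>(P y s - P x s) \<bullet> (snd (DH w) - snd (DH z))\<bar> \<le> norm (P y s - P x s) * norm (snd (DH w) - snd (DH z))"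
        by (rule Cauchy_Schwarz_ineq2)
      also have "\<dots> \<le> norm (w - z) * (K * norm (w - z))"
      proof (rule mult_mono)
        show "norm (P y s - P x s) \<le> norm (w - z)" by (simp add: w_def z_def norm_snd_le)
        show "norm (snd (DH w) - snd (DH z)) \<le> K * norm (w - z)"
        proof -
          show ?thesis using norm_snd_le_norm[of "DH w - DH z"] DH[of w z] by simp
        qed
      qed auto
      finally show ?thesis using H_remainder[of w z] by linarith
    qed
    also have "\<dots> = 2 * K * (norm (w - z))\<^sup>2" by (simp add: power2_eq_square)
    also have "\<dots> \<le> 2 * K * (flow_lip * norm (y - x))\<^sup>2"
      using K n by (intro mult_left_mono power_mono) auto
    finally show "\<bar>f' s\<bar> \<le> B" by (simp add: B_def power_mult_distrib)
  qed (use t in \<open>auto intro!: continuous_intros\<close>)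
  moreover have "B * T - B * t \<le> B * T" using t K by (simp add: B_def)
  moreover have "\<bar>f T\<bar> \<le> K * (norm (y - x))\<^sup>2"
    using G_remainder[of y x] by (simp add: f_def W inner_commute)
  ultimately have "\<bar>f t\<bar> \<le> (K + T * (2 * K * flow_lip\<^sup>2)) * (norm (y - x))\<^sup>2"
    by (simp add: B_def algebra_simps)
  also have "\<dots> \<le> (K + T * (2 * K * flow_lip\<^sup>2)) * (foot_lip * norm (X y t - X x t))\<^sup>2"
    using X_expanding[OF t] K T by (intro mult_left_mono power_mono) auto
  finally show ?thesis by (simp add: f_def remainder_bound_def power_mult_distrib)
qed

end

section \<open>Regularity up to the boundary\<close>

lemma quadratic_remainder_has_derivative_zero:
  fixes f :: "'a::real_normed_vector \<Rightarrow> real"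
  assumes "\<And>z. z \<in> S \<Longrightarrow> \<bar>f z\<bar> \<le> B * (norm (z - z0))\<^sup>2" and "z0 \<in> S"
  shows "(f has_derivative (\<lambda>h. 0)) (at z0 within S)"
proof -
  have B: "\<bar>f z\<bar> \<le> \<bar>B\<bar> * (norm (z - z0))\<^sup>2" if "z \<in> S" for z
    using assms(1)[OF that] by (meson abs_ge_self mult_right_mono order_trans zero_le_power2)
  have "f z0 = 0" using assms(1)[OF assms(2)] by simp
  then show ?thesis
    unfolding has_derivative_within_alt
  proof (intro conjI allI impI bounded_linear_zero)
    fix e :: real assume e: "e > 0"
    show "\<exists>d>0. \<forall>y\<in>S. norm (y - z0) < d \<longrightarrow> norm (f y - f z0 - 0) \<le> e * norm (y - z0)"
    proof (intro exI[of _ "e / (\<bar>B\<bar> + 1)"] conjI ballI impI)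
      show "0 < e / (\<bar>B\<bar> + 1)" using e by simp
      fix y assume y: "y \<in> S" and d: "norm (y - z0) < e / (\<bar>B\<bar> + 1)"
      have "\<bar>B\<bar> * norm (y - z0) \<le> (\<bar>B\<bar> + 1) * norm (y - z0)" by (intro mult_right_mono) auto
      also have "\<dots> \<le> e" using d by (simp add: field_simps)
      finally have "\<bar>B\<bar> * norm (y - z0) * norm (y - z0) \<le> e * norm (y - z0)" by (intro mult_right_mono) auto
      then show "norm (f y - f z0 - 0) \<le> e * norm (y - z0)"
        using B[OF y] \<open>f z0 = 0\<close> by (simp add: power2_eq_square mult.assoc)
    qed
  qed
qed

text \<open>A Lebesgue-number argument: the constants are uniform for pairs that are close and of which one point lies
  in the compact set.\<close>

lemma locally_lipschitz_on_compact:
  assumes f: "locally_lipschitz_on S f" and A: "compact A" "A \<subseteq> S"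
  obtains \<delta> B where "0 < \<delta>" "0 \<le> B"
    "\<And>z w. z \<in> A \<Longrightarrow> w \<in> S \<Longrightarrow> dist z w \<le> \<delta> \<Longrightarrow> dist (f z) (f w) \<le> B * dist z w"
proof -
  have "\<forall>z\<in>A. \<exists>r C. r > 0 \<and> C-lipschitz_on (S \<inter> cball z r) f"
    using f A unfolding locally_lipschitz_on_def by blast
  then obtain r C where rC: "\<And>z. z \<in> A \<Longrightarrow> r z > 0" "\<And>z. z \<in> A \<Longrightarrow> (C z)-lipschitz_on (S \<inter> cball z (r z)) f"
    by metis
  obtain D where D: "D \<subseteq> A" "finite D" "A \<subseteq> (\<Union>z\<in>D. ball z (r z / 2))"
  proof (rule compactE_image[OF A(1), of A "\<lambda>z. ball z (r z / 2)"])
    show "A \<subseteq> (\<Union>z\<in>A. ball z (r z / 2))" using rC(1) by fastforce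
  qed auto
  define \<delta> where "\<delta> = Min (insert 1 ((\<lambda>z. r z / 2) ` D))"
  define B where "B = Max (insert 0 (C ` D))"
  have \<delta>: "0 < \<delta>" using D rC(1) by (auto simp: \<delta>_def)
  have \<delta>_le: "\<delta> \<le> r z / 2" if "z \<in> D" for z
    unfolding \<delta>_def using D that by (intro Min_le) auto
  have B: "0 \<le> B" "\<And>z. z \<in> D \<Longrightarrow> C z \<le> B"
    using D by (auto simp: B_def)
  show ?thesis
  proof (rule that[OF \<delta> B(1)])
    fix z w assume z: "z \<in> A" and w: "w \<in> S" and d: "dist z w \<le> \<delta>"
    obtain y where y: "y \<in> D" "dist y z < r y / 2" using D z by auto
    have "dist y w \<le> dist y z + dist z w" by (rule dist_triangle)
    then have "dist y w \<le> r y" using y d \<delta>_le[OF y(1)] by linarith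
    then have "dist (f z) (f w) \<le> C y * dist z w"
      using y z w A D rC(1)[of y] by (intro lipschitz_onD[OF rC(2)]) auto
    also have "\<dots> \<le> B * dist z w" using B(2)[OF y(1)] by (intro mult_right_mono) auto
    finally show "dist (f z) (f w) \<le> B * dist z w" .
  qed
qed

lemma locally_lipschitz_on_continuous:
  assumes "locally_lipschitz_on S f"
  shows "continuous_on S f"
  unfolding continuous_on_eq_continuous_within
proof
  fix z assume z: "z \<in> S"
  then obtain r C where r: "r > 0" and C: "C-lipschitz_on (S \<inter> cball z r) f"
    using assms unfolding locally_lipschitz_on_def by blast
  from C have "continuous_on (S \<inter> cball z r) f" by (rule lipschitz_on_continuous_on)
  then have "continuous (at z within S \<inter> cball z r) f"
    using z r by (simp add: continuous_on_eq_continuous_within)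
  moreover have "at z within S \<inter> cball z r = at z within S"
    by (rule at_within_nhd[of _ "ball z r"]) (use r in auto)
  ultimately show "continuous (at z within S) f" by simp
qed

text \<open>A derivative within the closed strip yields the full spatial derivative at every time, and the full
  time derivative at interior times.\<close>

context
  fixes u :: "real \<times> 'a::euclidean_space \<Rightarrow> real" and D :: "real \<times> 'a" and T t :: real and x :: 'a
  assumes D: "(u has_derivative (\<lambda>h. h \<bullet> D)) (at (t, x) within {0..T} \<times> UNIV)"
begin

lemma strip_space_derivative:
  assumes t: "t \<in> {0..T}"
  shows "((\<lambda>y. u (t, y)) has_derivative (\<lambda>h. h \<bullet> snd D)) (at x)"
proof -
  have "((\<lambda>y. (t, y)) has_derivative (\<lambda>h. (0, h))) (at x)"
    by (auto intro!: derivative_eq_intros)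
  moreover have "(u has_derivative (\<lambda>h. h \<bullet> D)) (at (t, x) within (\<lambda>y. (t, y)) ` UNIV)"
    by (rule has_derivative_subset[OF D]) (use t in auto)
  ultimately have "((\<lambda>y. u (t, y)) has_derivative (\<lambda>h. (0, h) \<bullet> D)) (at x)"
    by (rule has_derivative_in_compose)
  then show ?thesis by (simp add: inner_prod_def)
qed

lemma strip_interior_derivative:
  assumes t: "t \<in> {0<..<T}"
  shows "(u has_derivative (\<lambda>h. h \<bullet> D)) (at (t, x))"
proof -
  have "at (t, x) within {0..T} \<times> UNIV = at (t, x)"
  proof (rule at_within_interior)
    have "open ({0<..<T} \<times> (UNIV :: 'a set))" by (intro open_Times) auto
    moreover have "(t, x) \<in> {0<..<T} \<times> UNIV" using t by simp
    ultimately show "(t, x) \<in> interior ({0..T} \<times> UNIV)" by (rule interiorI) auto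
  qed
  then show ?thesis using D by simp
qed

lemma strip_time_derivative:
  assumes t: "t \<in> {0<..<T}"
  shows "DERIV (\<lambda>s. u (s, x)) t :> fst D"
proof -
  have "((\<lambda>s. (s, x)) has_derivative (\<lambda>h. (h, 0))) (at t)"
    by (auto intro!: derivative_eq_intros)
  from has_derivative_compose[OF this strip_interior_derivative[OF t]]
  show ?thesis
    unfolding has_field_derivative_def
    by (rule has_derivative_eq_rhs) (auto simp: inner_prod_def mult.commute)
qed

end

context monotone_hamiltonian
begin

definition momentum :: "real \<Rightarrow> 'a \<Rightarrow> 'a" where
  "momentum t y = P (foot t y) t"

definition val :: "real \<times> 'a \<Rightarrow> real" where
  "val z = W (foot (fst z) (snd z)) (fst z)"

definition Dval :: "real \<times> 'a \<Rightarrow> real \<times> 'a" where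
  "Dval z = (H (snd z, momentum (fst z) (snd z)), momentum (fst z) (snd z))"

text \<open>Characteristics with terminal positions in a bounded set stay in a bounded set, where the field is bounded.\<close>

lemma charac_bounded_speed:
  obtains B where "0 \<le> B"
    "\<And>x s t. norm (x - x0) \<le> \<rho> \<Longrightarrow> s \<in> {0..T} \<Longrightarrow> t \<in> {0..T} \<Longrightarrow>
       norm (charac x t - charac x s) \<le> B * \<bar>t - s\<bar>"
proof -
  have "compact ((\<lambda>s. field (charac x0 s)) ` {0..T})"
    by (intro compact_continuous_image continuous_on_compose2[OF continuous_field[of UNIV]]
        solves_ode_continuous[OF charac(2)]) auto
  then obtain B0 where B0: "\<And>s. s \<in> {0..T} \<Longrightarrow> norm (field (charac x0 s)) \<le> B0"
    by (fastforce dest!: compact_imp_bounded simp: bounded_iff)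
  define B where "B = B0 + K * (flow_lip * \<bar>\<rho>\<bar>)"
  have B0_0: "0 \<le> B0" using order_trans[OF norm_ge_zero B0[of 0]] T by simp
  have "0 \<le> B" using B0_0 K flow_lip by (simp add: B_def)
  moreover have "norm (charac x t - charac x s) \<le> B * \<bar>t - s\<bar>"
    if x: "norm (x - x0) \<le> \<rho>" and s: "s \<in> {0..T}" and t: "t \<in> {0..T}" for x s t
  proof -
    have "norm (charac x t - charac x s) \<le> B * norm (t - s)"
    proof (rule differentiable_bound[where S="{0..T}" and f'="\<lambda>r h. h *\<^sub>R field (charac x r)"])
      fix r assume r: "r \<in> {0..T}"
      show "(charac x has_derivative (\<lambda>h. h *\<^sub>R field (charac x r))) (at r within {0..T})"
        using charac_deriv[OF r] by (simp add: has_vector_derivative_def)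
      have "norm (field (charac x r)) \<le> norm (field (charac x0 r)) + norm (field (charac x r) - field (charac x0 r))"
        by (rule norm_triangle_sub)
      also have "\<dots> \<le> B0 + K * (flow_lip * norm (x - x0))"
        by (intro add_mono B0[OF r] order_trans[OF field_lipschitz] mult_left_mono charac_lipschitz[OF r] K)
      also have "\<dots> \<le> B" unfolding B_def using x K flow_lip by (intro add_mono mult_left_mono) auto
      finally show "onorm (\<lambda>h. h *\<^sub>R field (charac x r)) \<le> B"
        by (intro onorm_le) (simp add: mult.commute[of B] mult_left_mono)
    qed (use s t in auto)
    then show ?thesis by simp
  qed
  ultimately show ?thesis using that by blast
qed

lemma charac_foot: "t \<in> {0..T} \<Longrightarrow> charac (foot t y) t = (y, momentum t y)"
  by (simp add: charac_eq momentum_def)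

text \<open>Two points \<open>(t, y)\<close> and \<open>(s, y')\<close> are compared through the characteristic of the first at time \<open>s\<close>: its motion is
  controlled by a speed bound that is uniform for feet near \<open>x0\<close>, and the remaining distance at the
  common time \<open>s\<close> by the expansion estimate.\<close>

lemma foot_charac_lipschitz:
  assumes t0: "t0 \<in> {0..T}"
  obtains B where "0 \<le> B"
    "\<And>t s y y'. t \<in> {0..T} \<Longrightarrow> s \<in> {0..T} \<Longrightarrow> norm (y - y0) \<le> 1 \<Longrightarrow> norm (y' - y0) \<le> 1 \<Longrightarrow>
       norm ((y, momentum t y) - (y', momentum s y')) \<le> B * norm ((t, y) - (s, y'))"
proof -
  define x0 where "x0 = foot t0 y0"
  have x0: "X x0 t0 = y0" using t0 by (simp add: x0_def)
  obtain B0 where B0: "0 \<le> B0"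
    "\<And>x s t. norm (x - x0) \<le> 0 \<Longrightarrow> s \<in> {0..T} \<Longrightarrow> t \<in> {0..T} \<Longrightarrow>
       norm (charac x t - charac x s) \<le> B0 * \<bar>t - s\<bar>"
    using charac_bounded_speed by blast
  define \<rho> where "\<rho> = foot_lip * (1 + B0 * T)"
  obtain B1 where B1: "0 \<le> B1"
    "\<And>x s t. norm (x - x0) \<le> \<rho> \<Longrightarrow> s \<in> {0..T} \<Longrightarrow> t \<in> {0..T} \<Longrightarrow>
       norm (charac x t - charac x s) \<le> B1 * \<bar>t - s\<bar>"
    using charac_bounded_speed by blast
  have near: "norm (foot t y - x0) \<le> \<rho>" if t: "t \<in> {0..T}" and y: "norm (y - y0) \<le> 1" for t y
  proof -
    have "norm (foot t y - x0) \<le> foot_lip * norm (y - X x0 t)"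
      using X_expanding[OF t, of "foot t y" x0] t by simp
    also have "norm (y - X x0 t) \<le> norm (y - y0) + norm (X x0 t0 - X x0 t)"
      using norm_triangle_ineq[of "y - y0" "X x0 t0 - X x0 t"] by (simp add: x0)
    also have "\<dots> \<le> 1 + B0 * T"
    proof -
      have "norm (X x0 t0 - X x0 t) \<le> norm (charac x0 t0 - charac x0 t)"
        by (simp add: charac_eq norm_fst_le)
      also have "\<dots> \<le> B0 * \<bar>t0 - t\<bar>" using B0(2)[of x0 t t0] t t0 by simp
      also have "\<dots> \<le> B0 * T" using t t0 B0(1) by (intro mult_left_mono) auto
      finally show ?thesis using y by linarith
    qed
    finally show ?thesis using foot_lip by (simp add: \<rho>_def)
  qed
  define B where "B = B1 + flow_lip * foot_lip * (1 + B1)"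
  have "0 \<le> B" using B1 flow_lip foot_lip by (simp add: B_def)
  moreover have "norm ((y, momentum t y) - (y', momentum s y')) \<le> B * norm ((t, y) - (s, y'))"
    if t: "t \<in> {0..T}" and s: "s \<in> {0..T}" and y: "norm (y - y0) \<le> 1" "norm (y' - y0) \<le> 1" for t s y y'
  proof -
    define n where "n = norm ((t, y) - (s, y'))"
    have n: "\<bar>t - s\<bar> \<le> n" "norm (y - y') \<le> n"
      using norm_fst_le[of "t - s" "y - y'"] norm_snd_le[of "y - y'" "t - s"] by (auto simp: n_def)
    define x1 where "x1 = foot t y"
    define x2 where "x2 = foot s y'"
    have x12: "X x1 t = y" "X x2 s = y'" using t s by (simp_all add: x1_def x2_def)
    have c1: "norm (charac x1 t - charac x1 s) \<le> B1 * n"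
      using B1(2)[OF near[OF t y(1)] s t] n(1) B1(1) unfolding x1_def by (meson mult_left_mono order_trans)
    have "norm (X x1 s - X x2 s) \<le> norm (X x1 s - X x1 t) + norm (y - y')"
      using norm_triangle_ineq[of "X x1 s - X x1 t" "y - y'"] by (simp add: x12)
    also have "norm (X x1 s - X x1 t) \<le> norm (charac x1 t - charac x1 s)"
      using norm_fst_le[of "X x1 t - X x1 s" "P x1 t - P x1 s"] by (simp add: charac_eq norm_minus_commute)
    also have "\<dots> \<le> B1 * n" by (rule c1)
    also note n(2)
    finally have "norm (X x1 s - X x2 s) \<le> B1 * n + n" by simp
    then have "norm (x1 - x2) \<le> foot_lip * (B1 * n + n)"
      using foot_lip order_trans[OF X_expanding[OF s, of x1 x2] mult_left_mono] by simp
    then have "norm (charac x1 s - charac x2 s) \<le> flow_lip * (foot_lip * (B1 * n + n))"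
      using flow_lip by (intro order_trans[OF charac_lipschitz[OF s]] mult_left_mono) auto
    moreover have "norm (charac x1 t - charac x2 s) \<le> norm (charac x1 t - charac x1 s) + norm (charac x1 s - charac x2 s)"
      using norm_triangle_ineq[of "charac x1 t - charac x1 s" "charac x1 s - charac x2 s"] by simp
    ultimately have "norm (charac x1 t - charac x2 s) \<le> B * n"
      using c1 by (simp add: B_def algebra_simps)
    then show ?thesis using charac_foot[OF t, of y] charac_foot[OF s, of y'] by (simp add: x1_def x2_def n_def)
  qed
  ultimately show ?thesis using that by blast
qed

text \<open>The momentum is Lipschitz near every point, so \<open>(y, momentum)\<close> stays in a bounded set, on which \<open>H\<close> is
  Lipschitz because \<open>DH\<close> is bounded there.\<close>

lemma Dval_locally_lipschitz: "locally_lipschitz_on ({0..T} \<times> UNIV) Dval"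
  unfolding locally_lipschitz_on_def
proof
  fix z0 :: "real \<times> 'a" assume "z0 \<in> {0..T} \<times> UNIV"
  then obtain t0 y0 where z0: "z0 = (t0, y0)" and t0: "t0 \<in> {0..T}" by auto
  obtain B where B: "0 \<le> B"
    "\<And>t s y y'. t \<in> {0..T} \<Longrightarrow> s \<in> {0..T} \<Longrightarrow> norm (y - y0) \<le> 1 \<Longrightarrow> norm (y' - y0) \<le> 1 \<Longrightarrow>
       norm ((y, momentum t y) - (y', momentum s y')) \<le> B * norm ((t, y) - (s, y'))"
    using foot_charac_lipschitz[OF t0] by blast
  define q where "q z = (snd z, momentum (fst z) (snd z))" for z
  let ?N = "({0..T} \<times> UNIV) \<inter> cball z0 1"
  have q: "norm (q z - q w) \<le> B * norm (z - w)" if "z \<in> ?N" "w \<in> ?N" for z w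
  proof -
    have "norm (snd z - y0) \<le> 1" if "z \<in> ?N" for z
    proof -
      show ?thesis using norm_snd_le_norm[of "z - z0"] that by (simp add: z0 dist_norm norm_minus_commute)
    qed
    then show ?thesis
      using B(2)[of "fst z" "fst w" "snd z" "snd w"] that by (auto simp: q_def)
  qed
  define M where "M = norm (DH (q z0)) + K * B"
  have M: "norm (DH (q z)) \<le> M" if z: "z \<in> ?N" for z
  proof -
    have z0N: "z0 \<in> ?N" using z0 t0 by simp
    have "norm (z - z0) \<le> 1" using z by (simp add: dist_norm norm_minus_commute)
    then have "norm (q z - q z0) \<le> B"
      using order_trans[OF q[OF z z0N] mult_left_mono[OF _ B(1)], of 1] by simp
    then have "norm (DH (q z) - DH (q z0)) \<le> K * B"
      using DH[of "q z" "q z0"] K by (meson mult_left_mono order_trans)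
    then show ?thesis
      using norm_triangle_sub[of "DH (q z)" "DH (q z0)"] by (simp add: M_def)
  qed
  have M0: "0 \<le> M" using K B by (simp add: M_def)
  define C1 where "C1 = (M + 2 * K * B) * B + B"
  have "C1-lipschitz_on ?N Dval"
  proof (rule lipschitz_onI)
    fix z w assume z: "z \<in> ?N" and w: "w \<in> ?N"
    have "norm (z - w) \<le> 2"
      using z w dist_triangle[of z w z0] by (simp add: dist_norm norm_minus_commute)
    then have q2: "norm (q z - q w) \<le> 2 * B"
      using order_trans[OF q[OF z w] mult_left_mono[OF _ B(1)], of 2] by (simp add: mult.commute)
    have "\<bar>H (q z) - H (q w)\<bar> \<le> \<bar>(q z - q w) \<bullet> DH (q w)\<bar> + K * (norm (q z - q w))\<^sup>2"
      using H_remainder[of "q z" "q w"] by linarith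
    also have "\<dots> \<le> norm (q z - q w) * M + K * ((2 * B) * norm (q z - q w))"
    proof (rule add_mono)
      show "\<bar>(q z - q w) \<bullet> DH (q w)\<bar> \<le> norm (q z - q w) * M"
        using Cauchy_Schwarz_ineq2[of "q z - q w" "DH (q w)"] M[OF w] by (meson mult_left_mono norm_ge_zero order_trans)
      show "K * (norm (q z - q w))\<^sup>2 \<le> K * ((2 * B) * norm (q z - q w))"
        using q2 K by (intro mult_left_mono) (auto simp: power2_eq_square intro: mult_right_mono)
    qed
    also have "\<dots> = (M + 2 * K * B) * norm (q z - q w)" by (simp add: algebra_simps)
    finally have h: "\<bar>H (q z) - H (q w)\<bar> \<le> (M + 2 * K * B) * norm (q z - q w)" .
    have "norm (momentum (fst z) (snd z) - momentum (fst w) (snd w)) \<le> norm (q z - q w)"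
      by (simp add: q_def norm_snd_le)
    moreover have "norm (Dval z - Dval w) \<le> \<bar>H (q z) - H (q w)\<bar> + norm (momentum (fst z) (snd z) - momentum (fst w) (snd w))"
      using norm_Pair_le[of "H (q z) - H (q w)" "momentum (fst z) (snd z) - momentum (fst w) (snd w)"]
      by (simp add: Dval_def q_def)
    ultimately have "norm (Dval z - Dval w) \<le> (M + 2 * K * B + 1) * norm (q z - q w)"
      using h by (simp add: algebra_simps)
    also have "\<dots> \<le> (M + 2 * K * B + 1) * (B * norm (z - w))"
      using M0 K B q[OF z w] by (intro mult_left_mono) auto
    finally show "dist (Dval z) (Dval w) \<le> C1 * dist z w"
      by (simp add: C1_def dist_norm algebra_simps)
  qed (use M0 K B in \<open>auto simp: C1_def\<close>)
  then show "\<exists>r>0. \<exists>C. C-lipschitz_on ({0..T} \<times> UNIV \<inter> cball z0 r) Dval"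
    by (intro exI[of _ 1]) auto
qed

text \<open>Along the characteristic through \<open>z0\<close>, the first-order expansion \<open>\<phi>\<close> of the value in space is differentiable
  with the expected derivative, and the value differs from it by a quadratic remainder.\<close>

lemma val_has_derivative:
  assumes z0: "z0 \<in> {0..T} \<times> UNIV"
  shows "(val has_derivative (\<lambda>h. h \<bullet> Dval z0)) (at z0 within {0..T} \<times> UNIV)"
proof -
  obtain t0 y0 where tz: "z0 = (t0, y0)" and t0: "t0 \<in> {0..T}" using z0 by auto
  let ?S = "{0..T} \<times> (UNIV :: 'a set)"
  define x0 where "x0 = foot t0 y0"
  have x0: "X x0 t0 = y0" "P x0 t0 = momentum t0 y0" using t0 by (simp_all add: x0_def momentum_def)
  define p where "p = momentum t0 y0"
  define \<phi> where "\<phi> z = W x0 (fst z) + P x0 (fst z) \<bullet> (snd z - X x0 (fst z))" for z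
  have fstS: "fst ` ?S = {0..T}" by auto
  have fst: "((\<lambda>z. f (fst z)) has_derivative (\<lambda>h. fst h *\<^sub>R f')) (at z0 within ?S)"
    if "(f has_vector_derivative f') (at t0 within {0..T})" for f :: "real \<Rightarrow> 'b::real_normed_vector" and f'
  proof -
    have "(f has_derivative (\<lambda>h. h *\<^sub>R f')) (at (fst z0) within fst ` ?S)"
      using that unfolding has_vector_derivative_def fstS by (simp add: tz)
    from has_derivative_in_compose[OF has_derivative_fst[OF has_derivative_ident] this]
    show ?thesis .
  qed
  have "(\<phi> has_derivative (\<lambda>h. fst h *\<^sub>R (H (y0, p) - p \<bullet> snd (DH (y0, p)))
      + (P x0 (fst z0) \<bullet> (snd h - fst h *\<^sub>R (- snd (DH (y0, p))))
        + (fst h *\<^sub>R fst (DH (y0, p))) \<bullet> (snd z0 - X x0 (fst z0))))) (at z0 within ?S)"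
    unfolding \<phi>_def
    using W(2)[OF t0, of x0] XP_deriv[OF t0, of x0]
    by (intro has_derivative_add has_derivative_inner has_derivative_diff fst
        has_derivative_snd has_derivative_ident) (simp_all add: x0 p_def)
  then have D\<phi>: "(\<phi> has_derivative (\<lambda>h. h \<bullet> Dval z0)) (at z0 within ?S)"
    by (rule has_derivative_eq_rhs)
      (simp add: tz x0 Dval_def p_def inner_prod_def fun_eq_iff algebra_simps inner_commute)
  obtain B where B: "0 \<le> B"
    "\<And>x s t. norm (x - x0) \<le> 0 \<Longrightarrow> s \<in> {0..T} \<Longrightarrow> t \<in> {0..T} \<Longrightarrow>
       norm (charac x t - charac x s) \<le> B * \<bar>t - s\<bar>"
    using charac_bounded_speed by blast
  have "((\<lambda>z. val z - \<phi> z) has_derivative (\<lambda>h. 0)) (at z0 within ?S)"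
  proof (rule quadratic_remainder_has_derivative_zero)
    fix z assume "z \<in> ?S"
    then obtain s y where z: "z = (s, y)" and s: "s \<in> {0..T}" by auto
    define n where "n = norm (z - z0)"
    have n: "\<bar>s - t0\<bar> \<le> n" "norm (y - y0) \<le> n"
      using norm_fst_le[of "s - t0" "y - y0"] norm_snd_le[of "y - y0" "s - t0"] by (auto simp: n_def z tz)
    have "\<bar>val z - \<phi> z\<bar> = \<bar>W (foot s y) s - W x0 s - P x0 s \<bullet> (X (foot s y) s - X x0 s)\<bar>"
      using s by (simp add: val_def \<phi>_def z algebra_simps)
    also have "\<dots> \<le> remainder_bound * (norm (X (foot s y) s - X x0 s))\<^sup>2"
      by (rule W_remainder[OF s])
    also have "\<dots> = remainder_bound * (norm (y - X x0 s))\<^sup>2" using s by simp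
    also have "\<dots> \<le> remainder_bound * ((1 + B) * n)\<^sup>2"
    proof (intro mult_left_mono power_mono remainder_bound)
      have "norm (y - X x0 s) \<le> norm (y - y0) + norm (X x0 s - X x0 t0)"
        using norm_triangle_ineq4[of "y - y0" "X x0 s - X x0 t0"] by (simp add: x0)
      also have "norm (X x0 s - X x0 t0) \<le> norm (charac x0 s - charac x0 t0)"
        by (simp add: charac_eq norm_fst_le)
      also have "\<dots> \<le> B * \<bar>s - t0\<bar>" using B(2)[of x0 t0 s] s t0 by simp
      also have "\<dots> \<le> B * n" using n B by (intro mult_left_mono)
      finally show "norm (y - X x0 s) \<le> (1 + B) * n" using n by (simp add: algebra_simps)
    qed auto
    finally show "\<bar>val z - \<phi> z\<bar> \<le> (remainder_bound * (1 + B)\<^sup>2) * (norm (z - z0))\<^sup>2"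
      by (simp add: n_def power_mult_distrib mult.assoc)
  qed (use z0 in auto)
  from has_derivative_add[OF this D\<phi>] show ?thesis by simp
qed

end

section \<open>Solutions are transported by characteristics\<close>

context monotone_hamiltonian
begin

lemma val_T: "val (T, x) = G x"
  using T by (simp add: val_def W)

text \<open>The derivative of a \<open>C\<^sup>1\<^sup>,\<^sup>1\<close> function need not be differentiable along the curve, so the difference
  \<open>Q - R\<close> of \<open>Dv\<close> and the momentum is measured by the increment of \<open>v\<close> from the curve to its translate by
  \<open>h e\<close>, minus \<open>h R \<bullet> e\<close>. Its time derivative is \<open>O(h |Q - R|) + O(h\<^sup>2)\<close>; dividing by \<open>h\<close> and letting \<open>h\<close> tend to 0
  gives an integral inequality for \<open>|Q - R|\<close>, which the maximum \<open>m\<close> of \<open>exp (- l s) |Q - R|\<close> turns into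
  \<open>m \<le> m / 2\<close>.\<close>

lemma classical_solution_momentum:
  fixes v :: "real \<times> 'a \<Rightarrow> real" and Dv :: "real \<times> 'a \<Rightarrow> real \<times> 'a"
  assumes v: "\<And>z. z \<in> {0..T} \<times> UNIV \<Longrightarrow> (v has_derivative (\<lambda>h. h \<bullet> Dv z)) (at z within {0..T} \<times> UNIV)"
    and Dv: "locally_lipschitz_on ({0..T} \<times> UNIV) Dv"
    and eq: "\<And>t x. t \<in> {0<..<T} \<Longrightarrow> fst (Dv (t, x)) = H (x, snd (Dv (t, x)))"
    and t0: "0 \<le> t0" "t0 \<le> T"
    and z: "solves_ode field t0 T z" "z t0 = (y0, snd (Dv (t0, y0)))"
    and s: "s \<in> {t0..T}"
  shows "snd (Dv (s, fst (z s))) = snd (z s)"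
proof -
  define Y where "Y s = fst (z s)" for s
  define R where "R s = snd (z s)" for s
  define Q where "Q s = snd (Dv (s, Y s))" for s
  have zYR: "z s = (Y s, R s)" for s by (simp add: Y_def R_def)
  have contz: "continuous_on {t0..T} z" by (rule solves_ode_continuous[OF z(1)])
  have contY: "continuous_on {t0..T} Y" and contR: "continuous_on {t0..T} R"
    unfolding Y_def R_def using contz by (auto intro: continuous_intros)
  have dY: "(Y has_vector_derivative - snd (DH (z s))) (at s)"
    and dR: "(R has_vector_derivative fst (DH (z s))) (at s)" if "s \<in> {t0<..<T}" for s
    using solves_fieldD[OF solves_ode_interior[OF z(1) that]] by (simp_all add: Y_def[abs_def] R_def[abs_def])
  let ?S = "{0..T} \<times> (UNIV :: 'a set)"
  define A where "A = (\<lambda>s. (s, Y s)) ` {t0..T}"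
  have "compact A" unfolding A_def
    by (intro compact_continuous_image continuous_intros contY) auto
  moreover have "A \<subseteq> ?S" using t0 by (auto simp: A_def)
  ultimately obtain \<delta> B where \<delta>: "0 < \<delta>" and B: "0 \<le> B"
    and lip: "\<And>z w. z \<in> A \<Longrightarrow> w \<in> ?S \<Longrightarrow> dist z w \<le> \<delta> \<Longrightarrow> dist (Dv z) (Dv w) \<le> B * dist z w"
    using locally_lipschitz_on_compact[OF Dv] by blast
  have near: "norm (Dv (s, y) - Dv (s, Y s)) \<le> B * norm (y - Y s)"
    if "s \<in> {t0..T}" "norm (y - Y s) \<le> \<delta>" for s y
    using lip[of "(s, Y s)" "(s, y)"] that t0 by (auto simp: A_def dist_norm norm_minus_commute norm_Pair)
  have contQ: "continuous_on {t0..T} Q"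
    unfolding Q_def using t0
    by (intro continuous_intros continuous_on_compose2[OF locally_lipschitz_on_continuous[OF Dv]] contY) auto

  \<comment> \<open>the weight is chosen such that \<open>K (1 + B) / l \<le> 1 / 2\<close>\<close>
  define l where "l = 2 * (K * (1 + B)) + 1"
  have l: "0 < l" using K B by (simp add: l_def add_nonneg_pos)
  define d where "d s = exp (- l * s) * norm (Q s - R s)" for s
  have "continuous_on {t0..T} d" unfolding d_def by (intro continuous_intros contQ contR)
  then obtain s1 where s1: "s1 \<in> {t0..T}" and max: "\<And>s. s \<in> {t0..T} \<Longrightarrow> d s \<le> d s1"
    using continuous_attains_sup[of "{t0..T}" d] t0 by auto
  define m where "m = d s1"
  have m0: "0 \<le> m" by (simp add: m_def d_def)
  have gap: "norm (Q s - R s) \<le> m * exp (l * s)" if "s \<in> {t0..T}" for s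
  proof -
    have "exp (l * s) * d s \<le> exp (l * s) * m" using max[OF that] by (simp add: m_def)
    moreover have "exp (l * s) * d s = norm (Q s - R s)" by (simp add: d_def exp_minus field_simps)
    ultimately show ?thesis
      using mult_left_mono[OF max[OF that], of "exp (l * s)"] by (simp add: m_def mult.commute)
  qed
  \<comment> \<open>the direction in which the gap at the maximum is fully visible\<close>
  define e where "e = sgn (Q s1 - R s1)"
  have e: "norm e \<le> 1" by (simp add: e_def norm_sgn)
  define B2 where "B2 = K * (1 + B)\<^sup>2"
  have B2: "0 \<le> B2" using K by (simp add: B2_def)

  have main: "norm (Q s1 - R s1) \<le> K * (1 + B) * m * exp (l * s1) / l + (2 * B + B2 * T) * h"
    if h: "0 < h" "h \<le> \<delta>" for h
  proof -
    have he: "norm (h *\<^sub>R e) \<le> h" using e h by (simp add: mult_left_le)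
    define f where "f s = v (s, Y s + h *\<^sub>R e) - v (s, Y s) - h * (R s \<bullet> e)" for s
    have dv: "((\<lambda>s. v (s, Y s + k)) has_vector_derivative
        fst (Dv (s, Y s + k)) - snd (Dv (s, Y s + k)) \<bullet> snd (DH (z s))) (at s)"
      if s: "s \<in> {t0<..<T}" for s k
    proof -
      have s': "s \<in> {0<..<T}" "s \<in> {0..T}" using s t0 by auto
      have "((\<lambda>s. (s, Y s + k)) has_derivative (\<lambda>r. (r, r *\<^sub>R (- snd (DH (z s))) + 0))) (at s)"
        using dY[OF s] unfolding has_vector_derivative_def
        by (intro has_derivative_Pair has_derivative_add has_derivative_ident has_derivative_const)
      moreover have "(v has_derivative (\<lambda>h. h \<bullet> Dv (s, Y s + k))) (at (s, Y s + k))"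
        by (rule strip_interior_derivative[OF v s'(1)]) (use s' in auto)
      ultimately have "((\<lambda>s. v (s, Y s + k)) has_derivative
          (\<lambda>r. (r, r *\<^sub>R (- snd (DH (z s))) + 0) \<bullet> Dv (s, Y s + k))) (at s)"
        by (rule has_derivative_compose)
      then show ?thesis
        unfolding has_vector_derivative_def
        by (rule has_derivative_eq_rhs) (auto simp: inner_prod_def inner_commute algebra_simps)
    qed
    have contv: "continuous_on {t0..T} (\<lambda>s. v (s, Y s + k))" for k
    proof -
      have "continuous_on ?S v"
        unfolding continuous_on_eq_continuous_within using v has_derivative_continuous by blast
      moreover have "continuous_on {t0..T} (\<lambda>s. (s, Y s + k))" by (intro continuous_intros contY)
      ultimately show ?thesis by (rule continuous_on_compose2) (use t0 in auto)
    qed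
    have vh: "\<bar>v (s, Y s + h *\<^sub>R e) - v (s, Y s) - h * (Q s \<bullet> e)\<bar> \<le> B * h\<^sup>2" if s: "s \<in> {t0..T}" for s
    proof -
      have s': "s \<in> {0..T}" using s t0 by auto
      have "\<bar>v (s, Y s + h *\<^sub>R e) - v (s, Y s) - ((Y s + h *\<^sub>R e) - Y s) \<bullet> snd (Dv (s, Y s))\<bar>
          \<le> B * (norm ((Y s + h *\<^sub>R e) - Y s))\<^sup>2"
      proof (rule first_order_remainder[of _ _ "\<lambda>y. v (s, y)" "\<lambda>y. snd (Dv (s, y))"])
        fix y assume y: "y \<in> closed_segment (Y s) (Y s + h *\<^sub>R e)"
        show "((\<lambda>y. v (s, y)) has_derivative (\<lambda>h. h \<bullet> snd (Dv (s, y)))) (at y)"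
          by (rule strip_space_derivative[OF v s']) (use s' in auto)
        have "norm (y - Y s) \<le> norm (h *\<^sub>R e)"
          using segment_bound(1)[OF y] by (simp add: norm_minus_commute)
        then have "norm (y - Y s) \<le> \<delta>" using he h by linarith
        from order_trans[OF norm_snd_le_norm near[OF s this]]
        show "norm (snd (Dv (s, y)) - snd (Dv (s, Y s))) \<le> B * norm (y - Y s)" by simp
      qed (rule B)
      moreover have "B * (norm (h *\<^sub>R e))\<^sup>2 \<le> B * h\<^sup>2"
        using he B by (intro mult_left_mono power_mono) auto
      ultimately show ?thesis by (simp add: Q_def inner_commute)
    qed
    define f' where "f' s = (fst (Dv (s, Y s + h *\<^sub>R e)) - snd (Dv (s, Y s + h *\<^sub>R e)) \<bullet> snd (DH (z s)))
      - (fst (Dv (s, Y s + 0)) - snd (Dv (s, Y s + 0)) \<bullet> snd (DH (z s))) - h * (R s \<bullet> 0 + fst (DH (z s)) \<bullet> e)" for s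
    define g where "g s = (K * (1 + B) * m * h / l) * exp (l * s) + B2 * h\<^sup>2 * s" for s
    define g' where "g' s = (K * (1 + B) * m * h) * exp (l * s) + B2 * h\<^sup>2" for s
    have "\<bar>f s1 - f t0\<bar> \<le> g s1 - g t0"
    proof (rule derivative_bound_imp_le[where f=f and g=g and a=t0 and b=s1 and f'=f' and g'=g'])
      have sub: "{t0..s1} \<subseteq> {t0..T}" using s1 by auto
      show "continuous_on {t0..s1} f"
        unfolding f_def using contv[of 0]
        by (intro continuous_on_subset[OF _ sub] continuous_intros contv contR) auto
      show "continuous_on {t0..s1} g" unfolding g_def by (intro continuous_intros)
      fix s assume "s \<in> {t0<..<s1}"
      then have s: "s \<in> {t0<..<T}" "s \<in> {t0..T}" "s \<in> {0<..<T}" using s1 t0 by auto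
      show "(f has_vector_derivative f' s) (at s)"
        unfolding f_def f'_def
        using has_vector_derivative_diff[OF has_vector_derivative_diff[OF dv[OF s(1), of "h *\<^sub>R e"] dv[OF s(1), of 0]]
            has_vector_derivative_mult_right[OF has_vector_derivative_inner[OF dR[OF s(1)] has_vector_derivative_const[of e]], of h]]
        by simp
      show "(g has_vector_derivative g' s) (at s)"
        unfolding g_def g'_def has_real_derivative_iff_has_vector_derivative[symmetric]
        using l by (auto intro!: derivative_eq_intros)
      define a where "a = (Y s, Q s)"
      define b where "b = (Y s + h *\<^sub>R e, snd (Dv (s, Y s + h *\<^sub>R e)))"
      define \<Delta> where "\<Delta> = snd (Dv (s, Y s + h *\<^sub>R e)) - Q s"
      have "norm \<Delta> \<le> norm (Dv (s, Y s + h *\<^sub>R e) - Dv (s, Y s))"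
        unfolding \<Delta>_def Q_def using norm_snd_le_norm[of "Dv (s, Y s + h *\<^sub>R e) - Dv (s, Y s)"] by simp
      also have "\<dots> \<le> B * norm (h *\<^sub>R e)"
        using near[OF s(2), of "Y s + h *\<^sub>R e"] order_trans[OF he h(2)] by simp
      also have "\<dots> \<le> B * h" using he B by (rule mult_left_mono)
      finally have \<Delta>: "norm \<Delta> \<le> B * h" .
      have ba: "b - a = (h *\<^sub>R e, \<Delta>)" by (simp add: a_def b_def \<Delta>_def)
      have nba: "norm (b - a) \<le> (1 + B) * h"
        unfolding ba using norm_Pair_le[of "h *\<^sub>R e" \<Delta>] he \<Delta> by (simp add: algebra_simps)
      have az: "norm (a - z s) = norm (Q s - R s)" by (simp add: a_def zYR norm_Pair)
      have "f' s = (H b - H a) - \<Delta> \<bullet> snd (DH (z s)) - h * (fst (DH (z s)) \<bullet> e)"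
        using eq[OF s(3)] by (simp add: f'_def a_def b_def \<Delta>_def Q_def algebra_simps)
      also have "\<dots> = (H b - H a - (b - a) \<bullet> DH a) + (b - a) \<bullet> (DH a - DH (z s))"
        unfolding ba by (simp add: inner_prod_def inner_commute algebra_simps)
      also have "\<bar>\<dots>\<bar> \<le> K * (norm (b - a))\<^sup>2 + norm (b - a) * norm (DH a - DH (z s))"
        using H_remainder[of b a] Cauchy_Schwarz_ineq2[of "b - a" "DH a - DH (z s)"] by linarith
      also have "\<dots> \<le> K * ((1 + B) * h)\<^sup>2 + ((1 + B) * h) * (K * (m * exp (l * s)))"
      proof (intro add_mono mult_left_mono mult_mono power_mono nba K)
        have "norm (DH a - DH (z s)) \<le> K * norm (Q s - R s)" using DH[of a "z s"] az by simp
        also have "\<dots> \<le> K * (m * exp (l * s))" by (intro mult_left_mono gap[OF s(2)] K)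
        finally show "norm (DH a - DH (z s)) \<le> K * (m * exp (l * s))" .
      qed (use B h in auto)
      also have "\<dots> = g' s" by (simp add: g'_def B2_def power_mult_distrib)
      finally show "\<bar>f' s\<bar> \<le> g' s" .
    qed (use s1 in auto)
    moreover have "0 \<le> g t0"
      unfolding g_def using K B m0 h l B2 t0 by (intro add_nonneg_nonneg mult_nonneg_nonneg divide_nonneg_pos) auto
    moreover have "\<bar>f t0\<bar> \<le> B * h\<^sup>2"
      using vh[of t0] t0 z(2) by (simp add: f_def Q_def R_def Y_def)
    ultimately have "\<bar>f s1\<bar> \<le> g s1 + B * h\<^sup>2" by linarith
    moreover have "g s1 \<le> h * (K * (1 + B) * m * exp (l * s1) / l) + B2 * h\<^sup>2 * T"
      unfolding g_def using B2 s1 by (intro add_mono mult_left_mono) (auto simp: mult_ac)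
    moreover have "h * norm (Q s1 - R s1) = h * ((Q s1 - R s1) \<bullet> e)"
      by (cases "Q s1 = R s1") (simp_all add: e_def sgn_div_norm dot_square_norm power2_eq_square)
    moreover have "h * ((Q s1 - R s1) \<bullet> e) = f s1 - (v (s1, Y s1 + h *\<^sub>R e) - v (s1, Y s1) - h * (Q s1 \<bullet> e))"
      by (simp add: f_def inner_diff_left algebra_simps)
    ultimately have "h * norm (Q s1 - R s1) \<le> h * (K * (1 + B) * m * exp (l * s1) / l) + B2 * h\<^sup>2 * T + B * h\<^sup>2 + B * h\<^sup>2"
      using vh[OF s1] by linarith
    also have "\<dots> = h * (K * (1 + B) * m * exp (l * s1) / l + (2 * B + B2 * T) * h)"
      by (simp add: power2_eq_square algebra_simps)
    finally show ?thesis using h by (simp add: mult_le_cancel_left_pos)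
  qed
  have "((\<lambda>h. K * (1 + B) * m * exp (l * s1) / l + (2 * B + B2 * T) * h) \<longlongrightarrow>
      K * (1 + B) * m * exp (l * s1) / l + (2 * B + B2 * T) * 0) (at_right 0)"
    by (intro tendsto_intros)
  moreover have "eventually (\<lambda>h. norm (Q s1 - R s1) \<le> K * (1 + B) * m * exp (l * s1) / l + (2 * B + B2 * T) * h) (at_right 0)"
    using eventually_at_right_real[OF \<delta>] by eventually_elim (use main in auto)
  ultimately have "norm (Q s1 - R s1) \<le> K * (1 + B) * m * exp (l * s1) / l + (2 * B + B2 * T) * 0"
    by (intro tendsto_lowerbound) auto
  moreover have "norm (Q s1 - R s1) = exp (l * s1) * m"
    by (simp add: m_def d_def exp_minus field_simps)
  ultimately have "exp (l * s1) * m \<le> exp (l * s1) * (K * (1 + B) / l * m)"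
    by (simp add: mult_ac)
  then have "m \<le> K * (1 + B) / l * m" by (simp only: mult_le_cancel_left_pos[OF exp_gt_zero])
  moreover have "K * (1 + B) / l \<le> 1 / 2" using l by (simp add: l_def field_simps)
  ultimately have "m \<le> 1 / 2 * m" using m0 by (meson mult_right_mono order_trans)
  then have "m = 0" using m0 by simp
  then have "norm (Q s - R s) \<le> 0" using gap[OF s] by simp
  then show ?thesis by (simp add: Q_def R_def Y_def)
qed

text \<open>The characteristic started with the gradient of \<open>v\<close> keeps the momentum of \<open>v\<close>, hence ends with momentum
  \<open>DG\<close> and is the characteristic of its own end point; along it \<open>v\<close> and \<open>W\<close> have the same rate of change.\<close>

lemma classical_solution_eq_val:
  fixes v :: "real \<times> 'a \<Rightarrow> real" and Dv :: "real \<times> 'a \<Rightarrow> real \<times> 'a"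
  assumes v: "\<And>z. z \<in> {0..T} \<times> UNIV \<Longrightarrow> (v has_derivative (\<lambda>h. h \<bullet> Dv z)) (at z within {0..T} \<times> UNIV)"
    and Dv: "locally_lipschitz_on ({0..T} \<times> UNIV) Dv"
    and eq: "\<And>t x. t \<in> {0<..<T} \<Longrightarrow> fst (Dv (t, x)) = H (x, snd (Dv (t, x)))"
    and vT: "\<And>x. v (T, x) = G x"
    and t0: "t0 \<in> {0..T}"
  shows "v (t0, y0) = val (t0, y0)"
proof -
  obtain z where z: "z t0 = (y0, snd (Dv (t0, y0)))" "solves_ode field t0 T z"
  proof (rule lipschitz_ode_initial_value[OF field_lipschitz K])
    show "t0 \<le> T" using t0 by simp
  qed
  have Q: "snd (Dv (s, fst (z s))) = snd (z s)" if "s \<in> {t0..T}" for s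
    by (rule classical_solution_momentum[OF v Dv eq _ _ z(2) z(1) that]) (use t0 in auto)
  define x where "x = fst (z T)"
  have "((\<lambda>y. v (T, y)) has_derivative (\<lambda>h. h \<bullet> snd (Dv (T, x)))) (at x)"
    by (rule strip_space_derivative[OF v]) (use T in auto)
  then have "gradient G x = snd (Dv (T, x))"
    using vT by (intro gradient_eqI) (simp add: gderiv_def)
  moreover have "gradient G x = DG x" using G by (intro gradient_eqI) (simp add: gderiv_def)
  ultimately have zT: "z T = charac x T"
    using Q[of T] t0 by (intro prod_eqI) (auto simp: x_def charac)
  have sub: "solves_ode field t0 T (charac x)"
    by (rule solves_ode_subinterval[OF charac(2)]) (use t0 in auto)
  have zc: "z s = charac x s" if "s \<in> {t0..T}" for s
    using lipschitz_ode_terminal_dependence[OF field_lipschitz z(2) sub that] zT by simp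
  have XP: "X x s = fst (z s)" "P x s = snd (z s)" if "s \<in> {t0..T}" for s
    using zc[OF that] by (simp_all add: X_def P_def)
  have foot: "foot t0 y0 = x"
    using foot_X[OF t0, of x] XP[of t0] z(1) t0 by simp
  define f where "f s = v (s, X x s) - W x s" for s
  have "\<bar>f T - f t0\<bar> \<le> 0 - 0"
  proof (rule derivative_bound_imp_le[where f=f and a=t0 and b=T and f'="\<lambda>s. 0" and g'="\<lambda>s. 0" and g="\<lambda>s. 0"])
    have "continuous_on ({0..T} \<times> UNIV) v"
      unfolding continuous_on_eq_continuous_within using v has_derivative_continuous by blast
    moreover have "continuous_on {0..T} (\<lambda>s. (s, X x s))" by (intro continuous_intros continuous_XP)
    ultimately have "continuous_on {0..T} (\<lambda>s. v (s, X x s))" by (rule continuous_on_compose2) auto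
    then have "continuous_on {0..T} f" unfolding f_def by (intro continuous_intros W_continuous)
    then show "continuous_on {t0..T} f" by (rule continuous_on_subset) (use t0 in auto)
    fix s assume s: "s \<in> {t0<..<T}"
    then have s': "s \<in> {0<..<T}" "s \<in> {0..T}" "s \<in> {t0..T}" using t0 by auto
    have "((\<lambda>s. (s, X x s)) has_derivative (\<lambda>r. (r, r *\<^sub>R (- snd (DH (X x s, P x s)))))) (at s)"
      using XP_deriv_interior(1)[OF s'(1), of x] unfolding has_vector_derivative_def
      by (intro has_derivative_Pair has_derivative_ident)
    moreover have "(v has_derivative (\<lambda>h. h \<bullet> Dv (s, X x s))) (at (s, X x s))"
      by (rule strip_interior_derivative[OF v s'(1)]) (use s' in auto)
    ultimately have D: "((\<lambda>s. v (s, X x s)) has_derivative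
        (\<lambda>r. (r, r *\<^sub>R (- snd (DH (X x s, P x s)))) \<bullet> Dv (s, X x s))) (at s)"
      by (rule has_derivative_compose)
    have p: "snd (Dv (s, X x s)) = P x s" using Q[OF s'(3)] XP[OF s'(3)] by simp
    have "fst (Dv (s, X x s)) = H (X x s, P x s)" using eq[OF s'(1)] p by simp
    with p have "((\<lambda>s. v (s, X x s)) has_vector_derivative
        H (X x s, P x s) - P x s \<bullet> snd (DH (X x s, P x s))) (at s)"
      unfolding has_vector_derivative_def
      by (intro has_derivative_eq_rhs[OF D]) (auto simp: inner_prod_def inner_commute algebra_simps)
    from has_vector_derivative_diff[OF this W_deriv_interior[OF s'(1), of x]]
    show "(f has_vector_derivative 0) (at s)" by (simp add: f_def[abs_def])
  qed (use t0 in \<open>auto intro: has_vector_derivative_const\<close>)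
  moreover have "f T = 0" by (simp add: f_def vT W)
  moreover have "X x t0 = y0" using XP[of t0] z(1) t0 by simp
  ultimately show ?thesis by (simp add: f_def val_def foot)
qed

end

lemma monotone_hamiltonian_well_posed:
  fixes H :: "(real^'n) \<times> (real^'n) \<Rightarrow> real"
  assumes "monotone_hamiltonian H DH G DG K c C T"
  shows "HJ_well_posed H G T"
proof -
  interpret monotone_hamiltonian H DH G DG K c C T by fact
  have C11: "C11_loc_on ({0..T} \<times> UNIV) val"
    unfolding C11_loc_on_def using val_has_derivative Dval_locally_lipschitz by blast
  have "- deriv (\<lambda>s. val (s, x)) t + H (x, gradient (\<lambda>y. val (t, y)) x) = 0"
    if t: "t \<in> {0<..<T}" for t x
  proof -
    have D: "(val has_derivative (\<lambda>h. h \<bullet> Dval (t, x))) (at (t, x) within {0..T} \<times> UNIV)"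
      by (rule val_has_derivative) (use t in auto)
    have "deriv (\<lambda>s. val (s, x)) t = H (x, momentum t x)"
      using DERIV_imp_deriv[OF strip_time_derivative[OF D t]] by (simp add: Dval_def)
    moreover have "gradient (\<lambda>y. val (t, y)) x = momentum t x"
      using strip_space_derivative[OF D] t by (intro gradient_eqI) (simp add: gderiv_def Dval_def)
    ultimately show ?thesis by simp
  qed
  then have sol: "HJ_solution H G T val"
    unfolding HJ_solution_def using C11 val_T by blast
  have "v w = val w" if v: "HJ_solution H G T v" and w: "w \<in> {0..T} \<times> UNIV" for v w
  proof -
    obtain Dv where Dv: "\<And>z. z \<in> {0..T} \<times> UNIV \<Longrightarrow> (v has_derivative (\<lambda>h. h \<bullet> Dv z)) (at z within {0..T} \<times> UNIV)"
      "locally_lipschitz_on ({0..T} \<times> UNIV) Dv"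
      using v unfolding HJ_solution_def C11_loc_on_def by blast
    have "fst (Dv (t, x)) = H (x, snd (Dv (t, x)))" if t: "t \<in> {0<..<T}" for t x
    proof -
      have D: "(v has_derivative (\<lambda>h. h \<bullet> Dv (t, x))) (at (t, x) within {0..T} \<times> UNIV)"
        by (rule Dv) (use t in auto)
      have "deriv (\<lambda>s. v (s, x)) t = fst (Dv (t, x))"
        using DERIV_imp_deriv[OF strip_time_derivative[OF D t]] .
      moreover have "gradient (\<lambda>y. v (t, y)) x = snd (Dv (t, x))"
        using strip_space_derivative[OF D] t by (intro gradient_eqI) (simp add: gderiv_def)
      moreover have "- deriv (\<lambda>s. v (s, x)) t + H (x, gradient (\<lambda>y. v (t, y)) x) = 0"
        using v t unfolding HJ_solution_def by blast
      ultimately show ?thesis by simp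
    qed
    note eq = this
    have vT: "v (T, x) = G x" for x using v by (simp add: HJ_solution_def)
    obtain t y where ty: "w = (t, y)" "t \<in> {0..T}" using w by auto
    show ?thesis unfolding ty(1) by (rule classical_solution_eq_val[OF Dv eq vT ty(2)])
  qed
  note uniq = this
  show ?thesis
    unfolding HJ_well_posed_def
  proof (intro conjI allI impI ballI)
    show "\<exists>u. HJ_solution H G T u" using sol by blast
    fix u v z assume "HJ_solution H G T u" "HJ_solution H G T v" "z \<in> {0..T} \<times> (UNIV :: (real^'n) set)"
    then show "u z = v z" using uniq[of u z] uniq[of v z] by simp
  qed
qed

section \<open>Extreme eigenvalues of symmetric matrices\<close>

lemma matrix_vector_mult_symmetric:
  fixes A :: "real^'n^'n"
  assumes "transpose A = A"
  shows "x \<bullet> (A *v y) = y \<bullet> (A *v x)"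
  using dot_lmul_matrix[of x A y] transpose_matrix_vector[of A x] assms by (simp add: inner_commute)

lemma symmetric_matrixI:
  fixes A :: "real^'n^'n"
  assumes "\<And>x y. x \<bullet> (A *v y) = y \<bullet> (A *v x)"
  shows "transpose A = A"
proof -
  have "transpose A *v y = A *v y" for y
  proof -
    have "(transpose A *v y) \<bullet> x = (A *v y) \<bullet> x" for x
      using assms[of y x] by (simp add: transpose_matrix_vector dot_lmul_matrix inner_commute[of x])
    then have "\<forall>x. (transpose A *v y) \<bullet> x = (A *v y) \<bullet> x" by blast
    then show ?thesis by (simp only: vector_eq_rdot)
  qed
  then show ?thesis by (simp add: matrix_eq)
qed

text \<open>Eigenvectors for distinct eigenvalues are orthogonal, hence linearly independent.\<close>

lemma finite_eigenvalues:
  fixes A :: "real^'n^'n"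
  assumes A: "transpose A = A"
  shows "finite (eigenvalues A)"
proof -
  have "\<forall>k\<in>eigenvalues A. \<exists>v. v \<noteq> 0 \<and> A *v v = k *\<^sub>R v" by (simp add: eigenvalues_def)
  then obtain v where v: "\<And>k. k \<in> eigenvalues A \<Longrightarrow> v k \<noteq> 0 \<and> A *v v k = k *\<^sub>R v k"
    by metis
  have orth: "v k \<bullet> v l = 0" if "k \<in> eigenvalues A" "l \<in> eigenvalues A" "k \<noteq> l" for k l
  proof -
    have "l * (v k \<bullet> v l) = k * (v k \<bullet> v l)"
      using matrix_vector_mult_symmetric[OF A, of "v k" "v l"] v[OF that(1)] v[OF that(2)]
      by (simp add: inner_commute)
    then show ?thesis using that(3) by simp
  qed
  have "inj_on v (eigenvalues A)"
  proof (rule inj_onI)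
    fix k l assume "k \<in> eigenvalues A" "l \<in> eigenvalues A" "v k = v l"
    then show "k = l" using orth[of k l] v[of k] by auto
  qed
  moreover have "independent (v ` eigenvalues A)"
  proof (rule pairwise_orthogonal_independent)
    show "pairwise orthogonal (v ` eigenvalues A)"
      using orth by (auto simp: pairwise_def orthogonal_def)
    show "0 \<notin> v ` eigenvalues A" using v by force
  qed
  ultimately show ?thesis
    using independent_imp_finite finite_imageD by blast
qed

lemma linear_term_zero:
  fixes a b :: real
  assumes "\<And>t. 0 \<le> 2 * t * a + t\<^sup>2 * b"
  shows "a = 0"
proof (rule ccontr)
  assume a: "a \<noteq> 0"
  \<comment> \<open>the quadratic polynomial is negative at \<open>t = - a / N\<close>\<close>
  define N where "N = \<bar>b\<bar> + 1"
  have N: "N > 0" "b < 2 * N" by (auto simp: N_def)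
  have "0 \<le> 2 * (- a / N) * a + (- a / N)\<^sup>2 * b" by (rule assms)
  also have "\<dots> = (a / N)\<^sup>2 * (b - 2 * N)"
    using N by (simp add: field_simps power2_eq_square)
  also have "\<dots> < 0" using a N by (intro mult_pos_neg) auto
  finally show False by simp
qed

text \<open>The minimum of the quadratic form over the unit sphere is an eigenvalue: the form \<open>v \<bullet> (A v - k v)\<close> is
  nonnegative and vanishes at the minimiser \<open>e\<close>, so its derivative at \<open>e\<close> vanishes.\<close>

lemma rayleigh_min:
  fixes A :: "real^'n^'n"
  assumes A: "transpose A = A"
  shows "\<exists>k\<in>eigenvalues A. \<forall>v. k * (v \<bullet> v) \<le> v \<bullet> (A *v v)"
proof -
  have "continuous_on (sphere 0 1) (\<lambda>v. v \<bullet> (A *v v))"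
    by (intro continuous_intros linear_continuous_on matrix_vector_mul_bounded_linear)
  moreover have "sphere (0 :: real^'n) 1 \<noteq> {}" by simp
  ultimately obtain e where e: "e \<in> sphere 0 1" and min: "\<And>v. v \<in> sphere 0 1 \<Longrightarrow> e \<bullet> (A *v e) \<le> v \<bullet> (A *v v)"
    using continuous_attains_inf[OF compact_sphere, of 0 1 "\<lambda>v. v \<bullet> (A *v v)"] by blast
  define k where "k = e \<bullet> (A *v e)"
  have ne: "norm e = 1" using e by simp
  then have ee: "e \<bullet> e = 1" by (simp add: dot_square_norm)
  have le: "k * (v \<bullet> v) \<le> v \<bullet> (A *v v)" for v
  proof (cases "v = 0")
    case False
    have "k \<le> (v /\<^sub>R norm v) \<bullet> (A *v (v /\<^sub>R norm v))"
      unfolding k_def by (rule min) (use False in simp)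
    then show ?thesis
      using False by (simp add: matrix_vector_mult_scaleR dot_square_norm power2_eq_square field_simps)
  qed simp
  have "w \<bullet> (A *v e - k *\<^sub>R e) = 0" for w
  proof (rule linear_term_zero)
    fix t :: real
    have "0 \<le> (e + t *\<^sub>R w) \<bullet> (A *v (e + t *\<^sub>R w)) - k * ((e + t *\<^sub>R w) \<bullet> (e + t *\<^sub>R w))"
      using le[of "e + t *\<^sub>R w"] by simp
    also have "\<dots> = 2 * t * (w \<bullet> (A *v e - k *\<^sub>R e)) + t\<^sup>2 * (w \<bullet> (A *v w) - k * (w \<bullet> w))"
      using matrix_vector_mult_symmetric[OF A, of e w] ee
      by (simp add: matrix_vector_right_distrib matrix_vector_mult_scaleR inner_add_left inner_add_right
          inner_diff_right inner_commute k_def power2_eq_square algebra_simps)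
    finally show "0 \<le> 2 * t * (w \<bullet> (A *v e - k *\<^sub>R e)) + t\<^sup>2 * (w \<bullet> (A *v w) - k * (w \<bullet> w))" .
  qed
  from this[of "A *v e - k *\<^sub>R e"] have "A *v e = k *\<^sub>R e" by simp
  then have "k \<in> eigenvalues A" using ne by (auto simp: eigenvalues_def intro!: exI[of _ e])
  with le show ?thesis by (intro bexI[of _ k] allI)
qed

lemma matrix_vector_mult_uminus: "(- A) *v v = - (A *v v)"
  for A :: "real^'n^'m"
  by (simp add: matrix_vector_mult_def vec_eq_iff sum_negf)

lemma eigenvalues_uminusD:
  assumes "k \<in> eigenvalues (- A)"
  shows "- k \<in> eigenvalues A"
proof -
  obtain v where v: "v \<noteq> 0" "- (A *v v) = k *\<^sub>R v"
    using assms by (auto simp: eigenvalues_def matrix_vector_mult_uminus)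
  have "A *v v = - (- (A *v v))" by simp
  also have "\<dots> = (- k) *\<^sub>R v" unfolding v(2) by simp
  finally show ?thesis using v(1) unfolding eigenvalues_def by blast
qed

lemma lambda_min_le:
  fixes A :: "real^'n^'n"
  assumes A: "transpose A = A"
  shows "lambda_min A * (v \<bullet> v) \<le> v \<bullet> (A *v v)"
proof -
  obtain k where k: "k \<in> eigenvalues A" "\<forall>v. k * (v \<bullet> v) \<le> v \<bullet> (A *v v)"
    using rayleigh_min[OF A] by (rule bexE)
  have "lambda_min A \<le> k" unfolding lambda_min_def using finite_eigenvalues[OF A] k(1) by simp
  then have "lambda_min A * (v \<bullet> v) \<le> k * (v \<bullet> v)" by (intro mult_right_mono) auto
  then show ?thesis using k(2)[rule_format, of v] by linarith
qed

lemma lambda_max_ge: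
  fixes A :: "real^'n^'n"
  assumes A: "transpose A = A"
  shows "v \<bullet> (A *v v) \<le> lambda_max A * (v \<bullet> v)"
proof -
  have "transpose (- A) = - A" using A by (simp add: transpose_def vec_eq_iff)
  from rayleigh_min[OF this] obtain k where k: "k \<in> eigenvalues (- A)" "\<forall>v. k * (v \<bullet> v) \<le> v \<bullet> (- A *v v)"
    by (rule bexE)
  have "- k \<in> eigenvalues A" using k(1) by (rule eigenvalues_uminusD)
  then have "- k \<le> lambda_max A" unfolding lambda_max_def using finite_eigenvalues[OF A] by simp
  then have "- k * (v \<bullet> v) \<le> lambda_max A * (v \<bullet> v)" by (intro mult_right_mono) auto
  moreover have "v \<bullet> (- A *v v) = - (v \<bullet> (A *v v))"
    by (simp add: matrix_vector_mult_uminus)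
  ultimately show ?thesis using k(2)[rule_format, of v] by simp
qed

lemma eigenvalue_bound:
  assumes "k \<in> eigenvalues A" "\<And>v. \<bar>v \<bullet> (A *v v)\<bar> \<le> N * (v \<bullet> v)"
  shows "\<bar>k\<bar> \<le> N"
proof -
  obtain v where "v \<noteq> 0" "A *v v = k *\<^sub>R v" using assms(1) by (auto simp: eigenvalues_def)
  then show ?thesis using assms(2)[of v] by (simp add: abs_mult mult_le_cancel_right)
qed

lemma lambda_min_bound:
  assumes "transpose A = A" "\<And>v. \<bar>v \<bullet> (A *v v)\<bar> \<le> N * (v \<bullet> v)"
  shows "\<bar>lambda_min A\<bar> \<le> N"
proof (rule eigenvalue_bound[OF _ assms(2)])
  have "eigenvalues A \<noteq> {}" using rayleigh_min[OF assms(1)] by auto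
  then show "lambda_min A \<in> eigenvalues A"
    unfolding lambda_min_def using finite_eigenvalues[OF assms(1)] by (intro Min_in)
qed

lemma lambda_max_bound:
  assumes "transpose A = A" "\<And>v. \<bar>v \<bullet> (A *v v)\<bar> \<le> N * (v \<bullet> v)"
  shows "\<bar>lambda_max A\<bar> \<le> N"
proof (rule eigenvalue_bound[OF _ assms(2)])
  have "eigenvalues A \<noteq> {}" using rayleigh_min[OF assms(1)] by auto
  then show "lambda_max A \<in> eigenvalues A"
    unfolding lambda_max_def using finite_eigenvalues[OF assms(1)] by (intro Max_in)
qed

lemma Re_mat_symmetric: "transpose (Re_mat A) = Re_mat A"
  by (simp add: Re_mat_def transpose_def vec_eq_iff)

lemma Re_mat_quadratic_form: "v \<bullet> (Re_mat A *v v) = v \<bullet> (A *v v)"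
proof -
  have "Re_mat A *v v = (1/2) *\<^sub>R (A *v v + transpose A *v v)"
    by (simp add: Re_mat_def matrix_vector_mult_def vec_eq_iff sum_distrib_left algebra_simps sum.distrib)
  moreover have "v \<bullet> (transpose A *v v) = v \<bullet> (A *v v)"
    by (simp add: transpose_matrix_vector dot_lmul_matrix inner_commute[of v])
  ultimately show ?thesis by (simp add: inner_add_right)
qed

section \<open>Hessians\<close>

lemma gradient_mean_value:
  fixes g :: "'a::real_inner \<Rightarrow> 'a"
  assumes g: "\<And>x. (g has_derivative A x) (at x)"
  obtains x where "(g z - g w) \<bullet> a = A x (z - w) \<bullet> a"
proof -
  have "((\<lambda>s. g (w + s *\<^sub>R (z - w)) \<bullet> a) has_derivative (\<lambda>r. A (w + s *\<^sub>R (z - w)) (r *\<^sub>R (z - w)) \<bullet> a)) (at s)" for s :: real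
    by (intro has_derivative_inner_left has_derivative_compose[OF _ g])
      (auto intro!: derivative_eq_intros)
  then have "DERIV (\<lambda>s. g (w + s *\<^sub>R (z - w)) \<bullet> a) s :> A (w + s *\<^sub>R (z - w)) (z - w) \<bullet> a" for s
    unfolding has_field_derivative_def
    by (rule has_derivative_eq_rhs)
      (simp add: fun_eq_iff linear_scale[OF has_derivative_linear[OF g]])
  then obtain s :: real where "g (w + 1 *\<^sub>R (z - w)) \<bullet> a - g (w + 0 *\<^sub>R (z - w)) \<bullet> a
      = (1 - 0) * (A (w + s *\<^sub>R (z - w)) (z - w) \<bullet> a)"
    using MVT2[of 0 1 "\<lambda>s. g (w + s *\<^sub>R (z - w)) \<bullet> a"] by fastforce
  then show ?thesis using that by (simp add: inner_diff_left)
qed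

lemma jacobian_mult:
  fixes f :: "real^'m \<Rightarrow> real^'n"
  assumes "(f has_derivative f') (at x)"
  shows "jacobian f (at x) *v h = f' h"
proof -
  have "(f has_derivative (\<lambda>h. jacobian f (at x) *v h)) (at x)"
    using assms jacobian_works[of f "at x"] differentiableI by blast
  from has_derivative_unique[OF this assms] show ?thesis by (rule fun_cong)
qed

lemma C2_hessian:
  assumes "C2 f"
  shows "hessian f x *v h = frechet_derivative (gradient f) (at x) h"
  unfolding hessian_def by (rule jacobian_mult[OF C2_gradient(2)[OF assms]])

lemma hessian_symmetric:
  assumes "C2 f"
  shows "transpose (hessian f x) = hessian f x"
proof (rule symmetric_matrixI)
  show "h \<bullet> (hessian f x *v k) = k \<bullet> (hessian f x *v h)" for h k
    using second_derivative_symmetric[OF C2_gradient[OF assms], of x h k]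
    by (simp add: C2_hessian[OF assms] inner_commute)
qed

lemma lambda_G_le:
  assumes G: "C2 G" "bounded_second_derivatives G"
  shows "lambda_G G * (h \<bullet> h) \<le> frechet_derivative (gradient G) (at x) h \<bullet> h"
proof -
  obtain K where "\<forall>x. onorm (frechet_derivative (gradient G) (at x)) \<le> K"
    using gradient_lipschitz[OF G] by blast
  then have K: "onorm (frechet_derivative (gradient G) (at x)) \<le> K" for x by blast
  have "\<bar>v \<bullet> (hessian G y *v v)\<bar> \<le> K * (v \<bullet> v)" for v y
  proof -
    have "\<bar>v \<bullet> (hessian G y *v v)\<bar> \<le> norm v * norm (frechet_derivative (gradient G) (at y) v)"
      by (simp add: C2_hessian[OF G(1)] Cauchy_Schwarz_ineq2)
    also have "\<dots> \<le> norm v * (K * norm v)"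
      by (intro mult_left_mono order_trans[OF onorm[OF has_derivative_bounded_linear[OF C2_gradient(2)[OF G(1)]]]]
          mult_right_mono K) auto
    finally show ?thesis by (simp add: dot_square_norm power2_eq_square mult_ac)
  qed
  then have "\<bar>lambda_min (hessian G y)\<bar> \<le> K" for y
    by (intro lambda_min_bound hessian_symmetric G(1))
  then have "bdd_below (range (\<lambda>y. lambda_min (hessian G y)))"
    by (intro bdd_belowI2[of _ "- K"]) (simp add: abs_le_iff minus_le_iff)
  then have "lambda_G G \<le> lambda_min (hessian G x)"
    unfolding lambda_G_def by (intro cINF_lower) auto
  then have "lambda_G G * (h \<bullet> h) \<le> lambda_min (hessian G x) * (h \<bullet> h)"
    by (intro mult_right_mono) auto
  also have "\<dots> \<le> h \<bullet> (hessian G x *v h)" by (intro lambda_min_le hessian_symmetric G(1))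
  finally show ?thesis by (simp add: C2_hessian[OF G(1)] inner_commute)
qed

text \<open>The directional derivative of a convex function is nondecreasing along lines, by the tangent inequality,
  whereas a negative value would make it decrease to the right of \<open>x\<close> in direction \<open>b\<close>.\<close>

lemma convex_gradient_form_nonneg:
  fixes f :: "'a::euclidean_space \<Rightarrow> real"
  assumes f: "\<And>x. (f has_derivative (\<lambda>h. h \<bullet> g x)) (at x)"
    and g: "(g has_derivative A) (at x)"
    and convex: "convex_on UNIV f"
  shows "0 \<le> A b \<bullet> b"
proof (rule ccontr)
  assume "\<not> 0 \<le> A b \<bullet> b"
  then have neg: "A b \<bullet> b < 0" by simp
  define \<phi> where "\<phi> t = g (x + t *\<^sub>R b) \<bullet> b" for t :: real
  have lin: "linear A" using g by (rule has_derivative_linear)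
  have line: "((\<lambda>t. x + t *\<^sub>R b) has_derivative (\<lambda>t. t *\<^sub>R b)) (at t)" for t :: real
    by (auto intro!: derivative_eq_intros)
  have "((\<lambda>t. f (x + t *\<^sub>R b)) has_derivative (\<lambda>r. (r *\<^sub>R b) \<bullet> g (x + t *\<^sub>R b))) (at t)" for t :: real
    by (rule has_derivative_compose[OF line f])
  then have f': "((\<lambda>t. f (x + t *\<^sub>R b)) has_field_derivative \<phi> t) (at t)" for t :: real
    unfolding has_field_derivative_def
    by (rule has_derivative_eq_rhs) (simp add: \<phi>_def fun_eq_iff inner_commute)
  have conv: "convex_on UNIV (\<lambda>t::real. f (x + t *\<^sub>R b))"
  proof (rule convex_onI)
    fix t r s :: real assume t: "0 < t" "t < 1"
    have "x + ((1 - t) *\<^sub>R r + t *\<^sub>R s) *\<^sub>R b = (1 - t) *\<^sub>R (x + r *\<^sub>R b) + t *\<^sub>R (x + s *\<^sub>R b)"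
      by (simp add: algebra_simps)
    then show "f (x + ((1 - t) *\<^sub>R r + t *\<^sub>R s) *\<^sub>R b) \<le> (1 - t) * f (x + r *\<^sub>R b) + t * f (x + s *\<^sub>R b)"
      using convex_onD[OF convex, of t "x + r *\<^sub>R b" "x + s *\<^sub>R b"] t by simp
  qed simp
  have tangent: "f (x + s *\<^sub>R b) - f (x + t *\<^sub>R b) \<ge> \<phi> t * (s - t)" for s t :: real
    by (rule convex_on_imp_above_tangent[OF conv]) (use f' in auto)
  have mono: "\<phi> 0 \<le> \<phi> h" if "0 < h" for h
  proof -
    have "(\<phi> h - \<phi> 0) * h \<ge> 0"
      using tangent[of 0 h] tangent[of h 0] by (simp add: algebra_simps)
    then show ?thesis using that by (simp add: zero_le_mult_iff)
  qed
  have "((\<lambda>t. g (x + t *\<^sub>R b)) has_derivative (\<lambda>r. A (r *\<^sub>R b))) (at 0)"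
    by (rule has_derivative_compose[OF line]) (simp add: g)
  then have "(\<phi> has_derivative (\<lambda>r. A (r *\<^sub>R b) \<bullet> b)) (at 0)"
    unfolding \<phi>_def by (rule has_derivative_inner_left)
  then have "DERIV \<phi> 0 :> A b \<bullet> b"
    unfolding has_field_derivative_def
    by (rule has_derivative_eq_rhs) (simp add: fun_eq_iff linear_scale[OF lin])
  from DERIV_neg_dec_right[OF this neg]
  obtain d where d: "0 < d" "\<forall>h>0. h < d \<longrightarrow> \<phi> (0 + h) < \<phi> 0"
    by blast
  have "\<phi> (0 + d / 2) < \<phi> 0" by (rule d(2)[rule_format]) (use d(1) in auto)
  then show False using mono[of "d / 2"] d(1) by simp
qed

section \<open>Monotonicity of the Hamiltonian vector field\<close>

context
  fixes H :: "(real^'n) \<times> (real^'n) \<Rightarrow> real"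
  assumes C2: "C2 H" and bdd: "bounded_second_derivatives H"
    and convex: "\<And>x. convex_on UNIV (\<lambda>p. H (x, p))"
begin

abbreviation DH where "DH \<equiv> gradient H"
abbreviation D2H where "D2H z \<equiv> frechet_derivative DH (at z)"

lemma partial_gradients:
  shows "((\<lambda>y. H (y, p)) has_derivative (\<lambda>h. h \<bullet> fst (DH (x, p)))) (at x)"
    and "((\<lambda>q. H (x, q)) has_derivative (\<lambda>h. h \<bullet> snd (DH (x, p)))) (at p)"
    and "gradient (\<lambda>y. H (y, p)) x = fst (DH (x, p))"
    and "gradient (\<lambda>q. H (x, q)) p = snd (DH (x, p))"
proof -
  have x: "((\<lambda>y. (y, p)) has_derivative (\<lambda>h. (h, 0))) (at x)"
    by (auto intro!: derivative_eq_intros)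
  have p: "((\<lambda>q. (x, q)) has_derivative (\<lambda>h. (0, h))) (at p)"
    by (auto intro!: derivative_eq_intros)
  show *: "((\<lambda>y. H (y, p)) has_derivative (\<lambda>h. h \<bullet> fst (DH (x, p)))) (at x)"
    using has_derivative_compose[OF x C2_gradient(1)[OF C2]] by (simp add: inner_prod_def)
  show **: "((\<lambda>q. H (x, q)) has_derivative (\<lambda>h. h \<bullet> snd (DH (x, p)))) (at p)"
    using has_derivative_compose[OF p C2_gradient(1)[OF C2]] by (simp add: inner_prod_def)
  show "gradient (\<lambda>y. H (y, p)) x = fst (DH (x, p))" using * by (intro gradient_eqI) (simp add: gderiv_def)
  show "gradient (\<lambda>q. H (x, q)) p = snd (DH (x, p))" using ** by (intro gradient_eqI) (simp add: gderiv_def)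
qed

lemma partial_gradient_derivatives:
  shows "((\<lambda>y. DH (y, p)) has_derivative (\<lambda>h. D2H (x, p) (h, 0))) (at x)"
    and "((\<lambda>q. DH (x, q)) has_derivative (\<lambda>h. D2H (x, p) (0, h))) (at p)"
proof -
  have x: "((\<lambda>y. (y, p)) has_derivative (\<lambda>h. (h, 0))) (at x)"
    by (auto intro!: derivative_eq_intros)
  have p: "((\<lambda>q. (x, q)) has_derivative (\<lambda>h. (0, h))) (at p)"
    by (auto intro!: derivative_eq_intros)
  show "((\<lambda>y. DH (y, p)) has_derivative (\<lambda>h. D2H (x, p) (h, 0))) (at x)"
    by (rule has_derivative_compose[OF x C2_gradient(2)[OF C2]])
  show "((\<lambda>q. DH (x, q)) has_derivative (\<lambda>h. D2H (x, p) (0, h))) (at p)"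
    by (rule has_derivative_compose[OF p C2_gradient(2)[OF C2]])
qed

lemma hessian_blocks:
  shows "D_xx H x p *v h = fst (D2H (x, p) (h, 0))"
    and "D_pp H x p *v h = snd (D2H (x, p) (0, h))"
    and "D_xp H x p *v h = fst (D2H (x, p) (0, h))"
proof -
  show "D_xx H x p *v h = fst (D2H (x, p) (h, 0))"
    unfolding D_xx_def hessian_def partial_gradients(3)[abs_def]
    by (rule jacobian_mult has_derivative_fst partial_gradient_derivatives)+
  show "D_pp H x p *v h = snd (D2H (x, p) (0, h))"
    unfolding D_pp_def hessian_def partial_gradients(4)[abs_def]
    by (rule jacobian_mult has_derivative_snd partial_gradient_derivatives)+
  show "D_xp H x p *v h = fst (D2H (x, p) (0, h))"
    unfolding D_xp_def partial_gradients(3)[abs_def]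
    by (rule jacobian_mult has_derivative_fst partial_gradient_derivatives)+
qed

lemma D2H_symmetric: "D2H z h \<bullet> k = D2H z k \<bullet> h"
  by (rule second_derivative_symmetric[OF C2_gradient[OF C2]])

lemma D2H_linear: "linear (D2H z)"
  using C2_gradient(2)[OF C2] by (rule has_derivative_linear)

lemma block_forms:
  shows "v \<bullet> (D_xx H x p *v w) = D2H (x, p) (w, 0) \<bullet> (v, 0)"
    and "v \<bullet> (D_pp H x p *v w) = D2H (x, p) (0, w) \<bullet> (0, v)"
    and "v \<bullet> (D_xp H x p *v w) = D2H (x, p) (0, w) \<bullet> (v, 0)"
  by (simp_all add: hessian_blocks inner_prod_def inner_commute)

lemma D_xx_symmetric: "transpose (D_xx H x p) = D_xx H x p"
  by (rule symmetric_matrixI) (simp add: block_forms D2H_symmetric)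

lemma D2H_bound:
  "\<exists>N\<ge>0. (\<forall>z h. norm (D2H z h) \<le> N * norm h) \<and> (\<forall>z w. norm (DH z - DH w) \<le> N * norm (z - w))"
proof -
  obtain N where N: "0 \<le> N" "\<forall>z. onorm (D2H z) \<le> N"
    "\<forall>z w. norm (DH z - DH w) \<le> N * norm (z - w)"
    using gradient_lipschitz[OF C2 bdd] by blast
  have "norm (D2H z h) \<le> N * norm h" for z h
    using onorm[OF has_derivative_bounded_linear[OF C2_gradient(2)[OF C2]], of z h]
      mult_right_mono[OF N(2)[rule_format, of z], of "norm h"] by simp
  then show ?thesis using N by blast
qed

lemma block_bounds:
  "\<exists>N. \<forall>x p v. \<bar>v \<bullet> (D_xx H x p *v v)\<bar> \<le> N * (v \<bullet> v) \<and>
    \<bar>v \<bullet> (D_xp H x p *v v)\<bar> \<le> N * (v \<bullet> v) \<and> norm (D_pp H x p *v v) \<le> N * norm v"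
proof -
  obtain N where N: "\<forall>z h. norm (D2H z h) \<le> N * norm h"
    using D2H_bound by blast
  have form: "\<bar>D2H z h \<bullet> k\<bar> \<le> N * (v \<bullet> v)" if "norm h = norm v" "norm k = norm v" for z h k and v :: "real^'n"
  proof -
    have "\<bar>D2H z h \<bullet> k\<bar> \<le> (N * norm h) * norm k"
      by (rule order_trans[OF Cauchy_Schwarz_ineq2 mult_right_mono[OF N[rule_format]]]) simp
    then show ?thesis by (simp add: that dot_square_norm power2_eq_square mult.assoc)
  qed
  show ?thesis
  proof (intro exI[of _ N] allI conjI)
    fix x p v :: "real^'n"
    show "\<bar>v \<bullet> (D_xx H x p *v v)\<bar> \<le> N * (v \<bullet> v)"
      unfolding block_forms by (rule form) (simp_all add: norm_Pair)
    show "\<bar>v \<bullet> (D_xp H x p *v v)\<bar> \<le> N * (v \<bullet> v)"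
      unfolding block_forms by (rule form) (simp_all add: norm_Pair)
    show "norm (D_pp H x p *v v) \<le> N * norm v"
      using order_trans[OF norm_snd_le_norm N[rule_format, of "(x, p)" "(0, v)"]] by (simp add: hessian_blocks norm_Pair)
  qed
qed

lemma lambda_H_ge: "v \<bullet> (D_xx H x p *v v) \<le> lambda_H H * (v \<bullet> v)"
proof -
  obtain N where "\<forall>x p v. \<bar>v \<bullet> (D_xx H x p *v v)\<bar> \<le> N * (v \<bullet> v)"
    using block_bounds by blast
  then have N: "\<bar>v \<bullet> (D_xx H x p *v v)\<bar> \<le> N * (v \<bullet> v)" for x p v by blast
  have "\<bar>lambda_max (D_xx H y q)\<bar> \<le> N" for y q
    by (rule lambda_max_bound[OF D_xx_symmetric N])
  then have "bdd_above (range (\<lambda>(x, p). lambda_max (D_xx H x p)))"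
    by (intro bdd_aboveI2[of _ _ N]) (auto simp: abs_le_iff)
  from cSUP_upper[OF UNIV_I this, of "(x, p)"]
  have "lambda_max (D_xx H x p) \<le> lambda_H H" by (simp add: lambda_H_def)
  then have "lambda_max (D_xx H x p) * (v \<bullet> v) \<le> lambda_H H * (v \<bullet> v)"
    by (intro mult_right_mono) auto
  then show ?thesis using lambda_max_ge[OF D_xx_symmetric, of v x p] by linarith
qed

lemma lambda_0_le: "lambda_0 H * (v \<bullet> v) \<le> v \<bullet> (D_xp H x p *v v)"
proof -
  obtain N where "\<forall>x p v. \<bar>v \<bullet> (D_xp H x p *v v)\<bar> \<le> N * (v \<bullet> v)"
    using block_bounds by blast
  then have N: "\<bar>v \<bullet> (D_xp H x p *v v)\<bar> \<le> N * (v \<bullet> v)" for x p v by blast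
  have "\<bar>lambda_min (Re_mat (D_xp H y q))\<bar> \<le> N" for y q
    by (rule lambda_min_bound[OF Re_mat_symmetric]) (simp add: Re_mat_quadratic_form N)
  then have "- N \<le> lambda_min (Re_mat (D_xp H y q))" for y q
    by (simp add: abs_le_iff minus_le_iff)
  then have "bdd_below (range (\<lambda>(x, p). lambda_min (Re_mat (D_xp H x p))))"
    by (intro bdd_belowI2[of _ "- N"]) auto
  from cINF_lower[OF this UNIV_I, of "(x, p)"]
  have "lambda_0 H \<le> lambda_min (Re_mat (D_xp H x p))" by (simp add: lambda_0_def)
  then have "lambda_0 H * (v \<bullet> v) \<le> lambda_min (Re_mat (D_xp H x p)) * (v \<bullet> v)"
    by (intro mult_right_mono) auto
  also have "\<dots> \<le> v \<bullet> (Re_mat (D_xp H x p) *v v)" by (rule lambda_min_le[OF Re_mat_symmetric])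
  finally show ?thesis by (simp add: Re_mat_quadratic_form)
qed

lemma D_pp_norm_le: "norm (D_pp H x p *v v) \<le> D_pp_sup_norm H * norm v"
proof -
  obtain N where "\<forall>x p v. norm (D_pp H x p *v v) \<le> N * norm v"
    using block_bounds by blast
  then have N: "norm (D_pp H x p *v v) \<le> N * norm v" for x p v by blast
  have "bdd_above (range (\<lambda>(x, p). onorm (\<lambda>v. D_pp H x p *v v)))"
    by (intro bdd_aboveI2[of _ _ N]) (auto intro!: onorm_le N)
  from cSUP_upper[OF UNIV_I this, of "(x, p)"]
  have "onorm (\<lambda>v. D_pp H x p *v v) \<le> D_pp_sup_norm H" by (simp add: D_pp_sup_norm_def)
  then have "onorm (\<lambda>v. D_pp H x p *v v) * norm v \<le> D_pp_sup_norm H * norm v"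
    by (intro mult_right_mono) auto
  moreover have "norm (D_pp H x p *v v) \<le> onorm (\<lambda>v. D_pp H x p *v v) * norm v"
    by (rule onorm) (rule matrix_vector_mul_bounded_linear)
  ultimately show ?thesis by linarith
qed

lemma D_pp_form_le: "v \<bullet> (D_pp H x p *v v) \<le> D_pp_sup_norm H * (v \<bullet> v)"
proof -
  have "v \<bullet> (D_pp H x p *v v) \<le> norm v * norm (D_pp H x p *v v)" by (rule norm_cauchy_schwarz)
  also have "\<dots> \<le> norm v * (D_pp_sup_norm H * norm v)"
    by (intro mult_left_mono D_pp_norm_le) auto
  finally show ?thesis by (simp add: dot_square_norm power2_eq_square mult_ac)
qed

lemma D_pp_form_nonneg: "0 \<le> v \<bullet> (D_pp H x p *v v)"
proof -
  have "((\<lambda>q. snd (DH (x, q))) has_derivative (\<lambda>h. snd (D2H (x, p) (0, h)))) (at p)"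
    by (rule has_derivative_snd partial_gradient_derivatives)+
  from convex_gradient_form_nonneg[OF partial_gradients(2) this convex, of v]
  show ?thesis by (simp add: hessian_blocks inner_commute)
qed

text \<open>The \<open>x\<close>-\<open>p\<close> terms with \<open>\<eta>\<close> cancel by symmetry, and the \<open>p\<close>-\<open>p\<close> terms are completed to the square of
  \<open>\<eta> - d \<xi>\<close> minus \<open>d\<^sup>2\<close> times the form at \<open>\<xi>\<close>. The sign of \<open>d\<close> matters because only a lower bound for the
  mixed block is available.\<close>

lemma hamiltonian_form_lower_bound:
  assumes d: "d \<le> 0"
  shows "(- lambda_H H - 2 * d * lambda_0 H - d\<^sup>2 * D_pp_sup_norm H) * (\<xi> \<bullet> \<xi>)
    \<le> D2H (x, p) (\<xi>, \<eta>) \<bullet> (- \<xi>, \<eta> - (2 * d) *\<^sub>R \<xi>)"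
proof -
  define q where "q h k = D2H (x, p) h \<bullet> k" for h k
  have add: "q (h + h') k = q h k + q h' k" for h h' k
    by (simp add: q_def linear_add[OF D2H_linear] inner_add_left)
  have sc: "q (r *\<^sub>R h) k = r * q h k" for r h k
    by (simp add: q_def linear_scale[OF D2H_linear])
  have sym: "q h k = q k h" for h k unfolding q_def by (rule D2H_symmetric)
  have add': "q k (h + h') = q k h + q k h'" for h h' k by (simp add: q_def inner_add_right)
  have sc': "q k (r *\<^sub>R h) = r * q k h" for r h k by (simp add: q_def)
  define a where "a = (\<xi>, 0 :: real^'n)"
  define b where "b = (0 :: real^'n, \<eta>)"
  define f where "f = (0 :: real^'n, \<xi>)"
  have e1: "(\<xi>, \<eta>) = a + b" by (simp add: a_def b_def)
  have e2: "(- \<xi>, \<eta> - (2 * d) *\<^sub>R \<xi>) = (- 1) *\<^sub>R a + (b + (- 2 * d) *\<^sub>R f)"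
    by (simp add: a_def b_def f_def)
  have "D2H (x, p) (\<xi>, \<eta>) \<bullet> (- \<xi>, \<eta> - (2 * d) *\<^sub>R \<xi>)
      = - q a a - 2 * d * q f a + (q b b - 2 * d * q b f)"
    unfolding e1 e2 q_def[symmetric] add add' sc sc'
    using sym[of a b] sym[of a f] by (simp add: algebra_simps)
  also have "q b b - 2 * d * q b f = q (b + (- d) *\<^sub>R f) (b + (- d) *\<^sub>R f) - d\<^sup>2 * q f f"
    unfolding add add' sc sc' using sym[of b f] by (simp add: algebra_simps power2_eq_square)
  finally have eq: "D2H (x, p) (\<xi>, \<eta>) \<bullet> (- \<xi>, \<eta> - (2 * d) *\<^sub>R \<xi>)
      = - q a a - 2 * d * q f a + (q (b + (- d) *\<^sub>R f) (b + (- d) *\<^sub>R f) - d\<^sup>2 * q f f)" .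
  have "q a a \<le> lambda_H H * (\<xi> \<bullet> \<xi>)"
    using lambda_H_ge[of \<xi> x p] by (simp add: block_forms q_def a_def)
  moreover have "(- d) * (lambda_0 H * (\<xi> \<bullet> \<xi>)) \<le> (- d) * q f a"
    using lambda_0_le[of \<xi> x p] d by (intro mult_left_mono) (auto simp: block_forms q_def a_def f_def)
  moreover have "d\<^sup>2 * q f f \<le> d\<^sup>2 * (D_pp_sup_norm H * (\<xi> \<bullet> \<xi>))"
    using D_pp_form_le[of \<xi> x p] by (intro mult_left_mono) (auto simp: block_forms q_def f_def)
  moreover have "0 \<le> q (b + (- d) *\<^sub>R f) (b + (- d) *\<^sub>R f)"
    using D_pp_form_nonneg[of "\<eta> - d *\<^sub>R \<xi>" x p] by (simp add: block_forms q_def b_def f_def)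
  ultimately show ?thesis unfolding eq by (simp add: algebra_simps)
qed

lemma hamiltonian_gradient_monotone:
  assumes d: "d \<le> 0"
  shows "(- lambda_H H - 2 * d * lambda_0 H - d\<^sup>2 * D_pp_sup_norm H) * (norm (fst z - fst w))\<^sup>2
    \<le> (snd (DH z) - snd (DH w)) \<bullet> (snd z - snd w - (2 * d) *\<^sub>R (fst z - fst w))
      - (fst (DH z) - fst (DH w)) \<bullet> (fst z - fst w)"
proof -
  let ?\<xi> = "fst z - fst w" and ?\<eta> = "snd z - snd w"
  obtain y where y: "(DH z - DH w) \<bullet> (- ?\<xi>, ?\<eta> - (2 * d) *\<^sub>R ?\<xi>)
      = D2H y (z - w) \<bullet> (- ?\<xi>, ?\<eta> - (2 * d) *\<^sub>R ?\<xi>)"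
    using gradient_mean_value[OF C2_gradient(2)[OF C2]] by blast
  have zw: "z - w = (?\<xi>, ?\<eta>)" by (simp add: prod_eq_iff)
  have "(- lambda_H H - 2 * d * lambda_0 H - d\<^sup>2 * D_pp_sup_norm H) * (?\<xi> \<bullet> ?\<xi>)
    \<le> (DH z - DH w) \<bullet> (- ?\<xi>, ?\<eta> - (2 * d) *\<^sub>R ?\<xi>)"
    unfolding y zw using hamiltonian_form_lower_bound[OF d, of ?\<xi> "fst y" "snd y" ?\<eta>] by simp
  then show ?thesis
    unfolding inner_prod_def dot_square_norm fst_conv snd_conv fst_diff snd_diff inner_minus_right
    by linarith
qed

text \<open>If the supremum vanished, \<open>H (0, p)\<close> would be \<open>r + p \<bullet> b\<close>; testing the supremum with \<open>v = b + e\<close> and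
  \<open>p = k e\<close> for a unit vector \<open>e\<close> and large \<open>k\<close> contradicts this.\<close>

lemma D_pp_sup_norm_pos:
  assumes L: "\<And>x p. bdd_above (range (\<lambda>v. p \<bullet> v - L (x, - v)))"
    and HL: "\<And>x p. H (x, p) = (SUP v. p \<bullet> v - L (x, - v))"
  shows "0 < D_pp_sup_norm H"
proof (rule ccontr)
  assume "\<not> 0 < D_pp_sup_norm H"
  then have "D_pp_sup_norm H * norm v \<le> 0" for v :: "real^'n" by (simp add: mult_nonpos_nonneg)
  then have zero: "D_pp H 0 p *v v = 0" for p v
    using D_pp_norm_le[of 0 p v] by (meson norm_le_zero_iff order_trans)
  have "((\<lambda>q. snd (DH (0, q))) has_derivative (\<lambda>h. 0)) (at p within UNIV)" for p
  proof -
    have "((\<lambda>q. snd (DH (0, q))) has_derivative (\<lambda>h. snd (D2H (0, p) (0, h)))) (at p)"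
      by (rule has_derivative_snd partial_gradient_derivatives)+
    then show ?thesis using zero[of p] by (simp add: hessian_blocks)
  qed
  then obtain b where b: "\<And>p. snd (DH (0, p)) = b"
    using has_derivative_zero_constant[of UNIV "\<lambda>q. snd (DH (0, q))"] by auto
  have "((\<lambda>q. H (0, q) - q \<bullet> b) has_derivative (\<lambda>h. 0)) (at p within UNIV)" for p
    using has_derivative_diff[OF partial_gradients(2)[of 0 p] has_derivative_inner_left[OF has_derivative_ident, of b]]
    by (simp add: b)
  then obtain r where r: "\<And>p. H (0, p) - p \<bullet> b = r"
    using has_derivative_zero_constant[of UNIV "\<lambda>q. H (0, q) - q \<bullet> b"] by auto
  obtain e :: "real^'n" where e: "e \<in> Basis" using nonempty_Basis by blast
  define k where "k = \<bar>r + L (0, - (b + e))\<bar> + 1"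
  have "(k *\<^sub>R e) \<bullet> (b + e) - L (0, - (b + e)) \<le> H (0, k *\<^sub>R e)"
    unfolding HL by (rule cSUP_upper[OF UNIV_I L])
  also have "\<dots> = r + (k *\<^sub>R e) \<bullet> b" using r[of "k *\<^sub>R e"] by linarith
  finally have "k \<le> r + L (0, - (b + e))"
    using e by (simp add: inner_add_right algebra_simps)
  then show False by (simp add: k_def)
qed

end

lemma gradient_strongly_monotone:
  assumes G: "C2 G" "bounded_second_derivatives G"
  shows "lambda_G G * (norm (x - y))\<^sup>2 \<le> (gradient G x - gradient G y) \<bullet> (x - y)"
proof -
  obtain z where "(gradient G x - gradient G y) \<bullet> (x - y) = frechet_derivative (gradient G) (at z) (x - y) \<bullet> (x - y)"
    using gradient_mean_value[OF C2_gradient(2)[OF G(1)]] by blast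
  then show ?thesis using lambda_G_le[OF G, of "x - y" z] by (simp add: dot_square_norm)
qed

text \<open>If \<open>l0 < 0\<close> then \<open>lH \<le> 0\<close>, so the square root is at least \<open>|l0|\<close> and the lower root is still
  nonpositive.\<close>

lemma nonpositive_riccati_root:
  fixes M l0 lH lG :: real
  assumes M: "0 < M" and disc: "M * lH \<le> l0\<^sup>2" and lG: "0 \<le> l0 + sqrt (l0\<^sup>2 - M * lH) + M * lG"
    and sign: "lH \<le> 0 \<or> 0 \<le> l0"
  obtains c where "c \<le> 0" "c \<le> lG" "- lH - 2 * c * l0 - c\<^sup>2 * M = 0"
proof -
  define s where "s = sqrt (l0\<^sup>2 - M * lH)"
  define c where "c = - (l0 + s) / M"
  have s: "0 \<le> s" "s\<^sup>2 = l0\<^sup>2 - M * lH" using disc by (simp_all add: s_def)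
  have "0 \<le> l0 + s"
  proof (cases "0 \<le> l0")
    case False
    then have "l0\<^sup>2 \<le> s\<^sup>2" using sign M s(2) by (simp add: mult_nonneg_nonpos)
    then have "\<bar>l0\<bar> \<le> s" using s(1) abs_le_square_iff[of l0 s] by simp
    then show ?thesis by linarith
  qed (use s in simp)
  then have "c \<le> 0" using M by (simp add: c_def field_simps)
  moreover have "c \<le> lG" using lG M by (simp add: c_def s_def field_simps)
  moreover have "- lH - 2 * c * l0 - c\<^sup>2 * M = 0"
  proof -
    have "c * M = - (l0 + s)" using M by (simp add: c_def)
    then have "(c * M + l0)\<^sup>2 = s\<^sup>2" by simp
    then have "M * (- lH - 2 * c * l0 - c\<^sup>2 * M) = 0" unfolding s(2) by (simp add: power2_eq_square algebra_simps)
    then show ?thesis using M by simp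
  qed
  ultimately show ?thesis using that by blast
qed

theorem theorem3p4:
  fixes H L :: "(real^'n) \<times> (real^'n) \<Rightarrow> real"
    and G :: "real^'n \<Rightarrow> real"
    and T :: real
  assumes "C2 H" and "bounded_second_derivatives H"
    and "C2 G" and "bounded_second_derivatives G"
    and "\<And>x. convex_on UNIV (\<lambda>p. H (x, p))"
    and "C2 L"
    and "\<And>x. convex_on UNIV (\<lambda>v. L (x, v))"
    and "\<And>x p. bdd_above (range (\<lambda>v. p \<bullet> v - L (x, - v)))"
    and "\<And>x p. H (x, p) = (SUP v. p \<bullet> v - L (x, - v))"
    and "(lambda_0 H)\<^sup>2 \<ge> D_pp_sup_norm H * lambda_H H"
    and "lambda_0 H + sqrt ((lambda_0 H)\<^sup>2 - D_pp_sup_norm H * lambda_H H)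
           + D_pp_sup_norm H * lambda_G G \<ge> 0"
    and "lambda_H H \<le> 0 \<or> lambda_0 H \<ge> 0"
    and "T > 0"
  shows "HJ_well_posed H G T"
proof -
  note H = assms(1,2,5)
  have M: "0 < D_pp_sup_norm H" by (rule D_pp_sup_norm_pos[OF H assms(8,9)])
  obtain c where c: "c \<le> 0" "c \<le> lambda_G G"
    "- lambda_H H - 2 * c * lambda_0 H - c\<^sup>2 * D_pp_sup_norm H = 0"
    by (rule nonpositive_riccati_root[OF M assms(10-12)])
  define C where "C = \<bar>- lambda_H H - 2 * (c - 1) * lambda_0 H - (c - 1)\<^sup>2 * D_pp_sup_norm H\<bar>"
  obtain KH where KH: "0 \<le> KH" "\<forall>z w. norm (gradient H z - gradient H w) \<le> KH * norm (z - w)"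
    using gradient_lipschitz[OF assms(1,2)] by blast
  obtain KG where KG: "0 \<le> KG" "\<forall>x y. norm (gradient G x - gradient G y) \<le> KG * norm (x - y)"
    using gradient_lipschitz[OF assms(3,4)] by blast
  define K where "K = max KH KG"
  have "monotone_hamiltonian H (gradient H) G (gradient G) K c C T"
  proof
    show "0 \<le> K" using KH by (simp add: K_def)
    show "0 \<le> C" by (simp add: C_def)
    show "0 < T" by fact
    show "(H has_derivative (\<lambda>h. h \<bullet> gradient H z)) (at z)" for z
      by (rule C2_gradient[OF assms(1)])
    show "(G has_derivative (\<lambda>h. h \<bullet> gradient G x)) (at x)" for x
      by (rule C2_gradient[OF assms(3)])
    show "norm (gradient H z - gradient H w) \<le> K * norm (z - w)" for z w
      by (rule order_trans[OF KH(2)[rule_format]]) (simp add: K_def mult_right_mono)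
    show "norm (gradient G x - gradient G y) \<le> K * norm (x - y)" for x y
      by (rule order_trans[OF KG(2)[rule_format]]) (simp add: K_def mult_right_mono)
    show "c * (norm (x - y))\<^sup>2 \<le> (gradient G x - gradient G y) \<bullet> (x - y)" for x y
      by (rule order_trans[OF _ gradient_strongly_monotone[OF assms(3,4)]]) (simp add: c(2) mult_right_mono)
  next
    fix z w :: "(real^'n) \<times> (real^'n)"
    show "0 \<le> (snd (gradient H z) - snd (gradient H w)) \<bullet> (snd z - snd w - (2 * c) *\<^sub>R (fst z - fst w))
        - (fst (gradient H z) - fst (gradient H w)) \<bullet> (fst z - fst w)"
      using hamiltonian_gradient_monotone[OF H c(1), of z w] unfolding c(3) by simp
    have "- C * (norm (fst z - fst w))\<^sup>2
        \<le> (- lambda_H H - 2 * (c - 1) * lambda_0 H - (c - 1)\<^sup>2 * D_pp_sup_norm H) * (norm (fst z - fst w))\<^sup>2"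
      by (intro mult_right_mono) (auto simp: C_def)
    also have "\<dots> \<le> (snd (gradient H z) - snd (gradient H w)) \<bullet> (snd z - snd w - (2 * (c - 1)) *\<^sub>R (fst z - fst w))
        - (fst (gradient H z) - fst (gradient H w)) \<bullet> (fst z - fst w)"
      by (rule hamiltonian_gradient_monotone[OF H]) (use c(1) in simp)
    finally show "- C * (norm (fst z - fst w))\<^sup>2
        \<le> (snd (gradient H z) - snd (gradient H w)) \<bullet> (snd z - snd w - (2 * (c - 1)) *\<^sub>R (fst z - fst w))
        - (fst (gradient H z) - fst (gradient H w)) \<bullet> (fst z - fst w)" .
  qed
  then show ?thesis by (rule monotone_hamiltonian_well_posed)
qed

end
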